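(* Consider the exact variance-reduced zeroth-order scheme (ZSOL$^{2s}_{ncnvx}$, exact) described in the context for the two-stage implicit problem $\min_{x\in\mathcal X}f^{\rm imp}(x)$ ($f^{\rm imp}$ possibly nonconvex), under Assumptions (B1)--(B3), (U') of the context. Then the following hold. (a) For any $\gamma<\frac{\eta}{nL_0}$, with $\ell:=\lceil\lambda K\rceil$, and all $K>\frac2{1-\lambda}$, $$\mathbb E\big[\|G_{\eta,1/\gamma}(x_R)\|^2\big]\le\frac{n^2L_0^2\gamma(0.5-\ln\lambda)\Big(1-\frac{nL_0\gamma}{2\eta}\Big)+\mathbb E[f^{\rm imp}(x_\ell)]-f^*+2L_0\eta}{\Big(1-\frac{nL_0\gamma}{\eta}\Big)\frac\gamma4(1-\lambda)K}.$$ (b) Suppose $\gamma=\frac{\eta}{2nL_0}$ and $\eta=\frac1{L_0}$. Let $\epsilon>0$ be an arbitrary scalar and let $K_\epsilon$ be such that $\mathbb E[\|G_{\eta,1/\gamma}(x_R)\|^2]\le\epsilon$. Then: (b-1) the total number of upper-level projection steps on $\mathcal X$ is $K_\epsilon=\mathcal O(n^2L_0^2\epsilon^{-1})$; (b-2) the total sample complexity of the upper level is $\mathcal O(n^4L_0^4\epsilon^{-2})$.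
   Context: Notation. $\mathbb B$ and $\mathbb S$ are the Euclidean unit ball and unit sphere of $\mathbb R^n$; $\Pi_C$ is Euclidean projection onto $C$; $\mathcal O(\cdot)$ hides factors not depending on $\epsilon,n,L_0$. Problem. $\mathcal X\subseteq\mathbb R^n$, $\mathcal Y\subseteq\mathbb R^m$; $\omega$ is a random variable on a probability space $(\Omega,\mathcal F,\mathbb P)$; $\tilde f(x,y,\omega)\in\mathbb R$, $G(x,y,\omega)\in\mathbb R^m$. The single-valued map $y(\cdot,\cdot)$ assigns to $(x,\omega)$ the solution $y(x,\omega)$ of VI$(\mathcal Y,G(x,\cdot,\omega))$: $y\in\mathcal Y$ and $(\tilde y-y)^TG(x,y,\omega)\ge0$ for all $\tilde y\in\mathcal Y$. The two-stage implicit problem is $\min_{x\in\mathcal X}f^{\rm imp}(x):=\mathbb E[\tilde f(x,y(x,\omega),\omega)]$, with optimal value $f^*$. For $\eta>0$, $f^{\rm imp}_\eta(x):=\mathbb E_u[f^{\rm imp}(x+\eta u)]$, $u$ uniform on $\mathbb B$. The residual mapping is $G_{\eta,\beta}(x):=\beta\big(x-\Pi_{\mathcal X}[x-\frac1\beta\nabla_xf^{\rm imp}_\eta(x)]\big)$ for $\beta>0$. Assumptions. (B1) For some $\eta_0>0$ and every $\omega$, $x\mapsto\tilde f(x,y(x,\omega),\omega)$ is $L_0(\omega)$-Lipschitz on $\mathcal X+\eta_0\mathbb B$ with $L_0:=\sqrt{\mathbb E[L_0^2(\omega)]}<\infty$; and $\tilde f(x,\cdot,\omega)$ is $\tilde L_0(\omega)$-Lipschitz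 for all $x\in\mathcal X+\eta_0\mathbb B$, with $\tilde L_0:=\sqrt{\mathbb E[\tilde L_0^2(\omega)]}<\infty$. (B2) $\mathcal X,\mathcal Y$ are nonempty, closed, bounded, convex. (B3) $G(x,\cdot,\omega)$ is $\mu_F(\omega)$-strongly monotone and $L_F(\omega)$-Lipschitz on $\mathcal Y$, uniformly in $x\in\mathcal X$, for every $\omega$, with $\inf_\omega\mu_F(\omega)\ge\mu_F$ and $\sup_\omega L_F(\omega)\le L_F$ for some $\mu_F,L_F\in(0,\infty)$. (U') Given the mini-batch size $N_k$ and the smoothing parameter $\eta>0$, at each iteration $k\ge0$, $v_{1,k},\dots,v_{N_k,k}$ are iid uniformly distributed on $\eta\mathbb S$ and $\omega_{1,k},\dots,\omega_{N_k,k}$ are iid replicates of $\omega$, independent of the $v_{j,k}$. Scheme (ZSOL$^{2s}_{ncnvx}$, exact). Given $x_0\in\mathcal X$, stepsize $\gamma>0$, smoothing parameter $\eta>0$, $N_k=k+1$, an integer $K$, $\lambda\in(0,1)$, and $R$ drawn uniformly at random from $\{\lceil\lambda K\rceil,\dots,K\}$. For each $k=0,\dots,K-1$ and $j=1,\dots,N_k$, with exact values $y(x_k,\omega_{j,k})$ and $y(x_k+v_{j,k},\omega_{j,k})$, set $$g_{j,k}=\frac{n\big(\tilde f(x_k+v_{j,k},y(x_k+v_{j,k},\omega_{j,k}),\omega_{j,k})-\tilde f(x_k,y(x_k,\omega_{j,k}),\omega_{j,k})\big)v_{j,k}}{\|v_{j,k}\|\eta},$$ $x_{k+1}=\Pi_{\mathcal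 X}\big[x_k-\gamma\frac1{N_k}\sum_{j=1}^{N_k}g_{j,k}\big]$. The output is $x_R$.
   Formalization: The smoothing parameter is required to satisfy η < η_0, with η_0 from (B1); without this the sampled points, or the gradient of the smoothed function at boundary points of X, depend on values of f^imp outside X+η_0 B, where nothing is assumed. *)

theory Defs
  imports "HOL-Probability.Probability"
begin

text \<open>
  Throughout, \<open>M\<close> is the probability space on which the random parameter \<open>\<omega>\<close> lives
  (a general random element is covered by taking its law for \<open>M\<close>), and \<open>Q\<close> is the
  probability space carrying all random draws of the scheme.
\<close>

definition enlargement :: "'a::euclidean_space set \<Rightarrow> real \<Rightarrow> 'a set" where
  "enlargement X r = {x + r *\<^sub>R b | x b. x \<in> X \<and> b \<in> cball 0 1}"

definition VI_solutions :: "'b::real_inner set \<Rightarrow> ('b \<Rightarrow> 'b) \<Rightarrow> 'b set" where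
  "VI_solutions Y F = {z \<in> Y. \<forall>z'\<in>Y. (z' - z) \<bullet> F z \<ge> 0}"

definition implicit_integrand ::
    "('a \<Rightarrow> 'b \<Rightarrow> 'w \<Rightarrow> real) \<Rightarrow> ('a \<Rightarrow> 'w \<Rightarrow> 'b) \<Rightarrow> 'a \<Rightarrow> 'w \<Rightarrow> real" where
  "implicit_integrand f y x \<omega> = f x (y x \<omega>) \<omega>"

definition f_imp ::
    "'w measure \<Rightarrow> ('a \<Rightarrow> 'b \<Rightarrow> 'w \<Rightarrow> real) \<Rightarrow> ('a \<Rightarrow> 'w \<Rightarrow> 'b) \<Rightarrow> 'a \<Rightarrow> real" where
  "f_imp M f y x = (\<integral>\<omega>. implicit_integrand f y x \<omega> \<partial>M)"

text \<open>
  The second-stage map and the objective only have to make sense on \<open>X + \<eta>0 B\<close>, the set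
  on which the objective is ever evaluated.
\<close>

definition two_stage_problem ::
    "'w measure \<Rightarrow> 'a::euclidean_space set \<Rightarrow> 'b::euclidean_space set \<Rightarrow> real \<Rightarrow>
     ('a \<Rightarrow> 'b \<Rightarrow> 'w \<Rightarrow> real) \<Rightarrow> ('a \<Rightarrow> 'b \<Rightarrow> 'w \<Rightarrow> 'b) \<Rightarrow> ('a \<Rightarrow> 'w \<Rightarrow> 'b) \<Rightarrow> bool" where
  "two_stage_problem M X Y \<eta>0 f G y \<longleftrightarrow>
     prob_space M \<and>
     (\<forall>x\<in>enlargement X \<eta>0. \<forall>\<omega>\<in>space M. VI_solutions Y (\<lambda>z. G x z \<omega>) = {y x \<omega>}) \<and>
     (\<forall>x\<in>enlargement X \<eta>0. integrable M (implicit_integrand f y x))"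

definition rms :: "'w measure \<Rightarrow> ('w \<Rightarrow> real) \<Rightarrow> real" where
  "rms M L = sqrt (\<integral>\<omega>. (L \<omega>)\<^sup>2 \<partial>M)"

definition assumption_B1 ::
    "'w measure \<Rightarrow> 'a::euclidean_space set \<Rightarrow> 'b::euclidean_space set \<Rightarrow> real \<Rightarrow>
     ('a \<Rightarrow> 'b \<Rightarrow> 'w \<Rightarrow> real) \<Rightarrow> ('a \<Rightarrow> 'w \<Rightarrow> 'b) \<Rightarrow> ('w \<Rightarrow> real) \<Rightarrow> ('w \<Rightarrow> real) \<Rightarrow> bool" where
  "assumption_B1 M X Y \<eta>0 f y lip lip' \<longleftrightarrow>
     \<eta>0 > 0 \<and>
     (\<forall>\<omega>\<in>space M. (lip \<omega>)-lipschitz_on (enlargement X \<eta>0) (\<lambda>x. implicit_integrand f y x \<omega>)) \<and>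
     lip \<in> borel_measurable M \<and> integrable M (\<lambda>\<omega>. (lip \<omega>)\<^sup>2) \<and>
     (\<forall>\<omega>\<in>space M. \<forall>x\<in>enlargement X \<eta>0. (lip' \<omega>)-lipschitz_on Y (\<lambda>z. f x z \<omega>)) \<and>
     lip' \<in> borel_measurable M \<and> integrable M (\<lambda>\<omega>. (lip' \<omega>)\<^sup>2)"

definition assumption_B2 :: "'a::euclidean_space set \<Rightarrow> 'b::euclidean_space set \<Rightarrow> bool" where
  "assumption_B2 X Y \<longleftrightarrow>
     X \<noteq> {} \<and> closed X \<and> bounded X \<and> convex X \<and>
     Y \<noteq> {} \<and> closed Y \<and> bounded Y \<and> convex Y"

definition strongly_monotone_on ::
    "real \<Rightarrow> 'b::real_inner set \<Rightarrow> ('b \<Rightarrow> 'b) \<Rightarrow> bool" where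
  "strongly_monotone_on \<mu> Y F \<longleftrightarrow>
     (\<forall>z\<in>Y. \<forall>z'\<in>Y. (F z - F z') \<bullet> (z - z') \<ge> \<mu> * (norm (z - z'))\<^sup>2)"

definition assumption_B3 ::
    "'w measure \<Rightarrow> 'a set \<Rightarrow> 'b::euclidean_space set \<Rightarrow> ('a \<Rightarrow> 'b \<Rightarrow> 'w \<Rightarrow> 'b) \<Rightarrow> bool" where
  "assumption_B3 M X Y G \<longleftrightarrow>
     (\<exists>(\<mu>F :: 'w \<Rightarrow> real) (LF :: 'w \<Rightarrow> real) \<mu> L.
        (\<forall>x\<in>X. \<forall>\<omega>\<in>space M. strongly_monotone_on (\<mu>F \<omega>) Y (\<lambda>z. G x z \<omega>) \<and>
                             (LF \<omega>)-lipschitz_on Y (\<lambda>z. G x z \<omega>)) \<and>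
        \<mu> > 0 \<and> L > 0 \<and> (\<forall>\<omega>\<in>space M. \<mu> \<le> \<mu>F \<omega> \<and> LF \<omega> \<le> L))"

text \<open>
  The expectation over \<open>u\<close> uniform on the unit ball, written as an average over the ball so
  that values of \<open>f\<close> outside \<open>x + \<eta> B\<close> (where it need not be measurable) do not matter.
\<close>

definition smoothed :: "real \<Rightarrow> ('a::euclidean_space \<Rightarrow> real) \<Rightarrow> 'a \<Rightarrow> real" where
  "smoothed \<eta> f x =
     (LINT u:cball 0 1|lborel. f (x + \<eta> *\<^sub>R u)) / measure lborel (cball (0::'a) 1)"

definition gradient :: "('a::real_inner \<Rightarrow> real) \<Rightarrow> 'a \<Rightarrow> 'a" where
  "gradient f x = (THE D. GDERIV f x :> D)"

definition residual ::
    "'a::euclidean_space set \<Rightarrow> ('a \<Rightarrow> real) \<Rightarrow> real \<Rightarrow> real \<Rightarrow> 'a \<Rightarrow> 'a" where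
  "residual X f \<eta> \<beta> x =
     \<beta> *\<^sub>R (x - closest_point X (x - (1 / \<beta>) *\<^sub>R gradient (smoothed \<eta> f) x))"

definition batch_size :: "nat \<Rightarrow> nat" where
  "batch_size k = k + 1"

text \<open>
  Normalised surface measure on the sphere of radius \<open>r\<close>: the measure of a set of directions
  is the normalised volume of the part of the unit ball lying over it.
\<close>

definition uniform_sphere :: "real \<Rightarrow> 'a::euclidean_space measure" where
  "uniform_sphere r = distr (uniform_measure lborel (cball 0 1)) borel (\<lambda>x. r *\<^sub>R sgn x)"

text \<open>\<open>Direction k j\<close> labels \<open>v k j\<close> and \<open>Replicate k j\<close> labels \<open>w k j\<close>, for
  iteration \<open>k\<close> and batch position \<open>j\<close>.\<close>

datatype draw = Direction nat nat | Replicate nat nat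

definition draws :: "draw set" where
  "draws = (\<Union>k. \<Union>j\<in>{1..batch_size k}. {Direction k j, Replicate k j})"

definition draw_events ::
    "'w measure \<Rightarrow> 'q measure \<Rightarrow> (nat \<Rightarrow> nat \<Rightarrow> 'q \<Rightarrow> 'a::euclidean_space) \<Rightarrow>
     (nat \<Rightarrow> nat \<Rightarrow> 'q \<Rightarrow> 'w) \<Rightarrow> draw \<Rightarrow> 'q set set" where
  "draw_events M Q v w d = (case d of
       Direction k j \<Rightarrow> sets (vimage_algebra (space Q) (v k j) borel)
     | Replicate k j \<Rightarrow> sets (vimage_algebra (space Q) (w k j) M))"

definition assumption_U ::
    "'w measure \<Rightarrow> 'q measure \<Rightarrow> real \<Rightarrow> (nat \<Rightarrow> nat \<Rightarrow> 'q \<Rightarrow> 'a::euclidean_space) \<Rightarrow>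
     (nat \<Rightarrow> nat \<Rightarrow> 'q \<Rightarrow> 'w) \<Rightarrow> bool" where
  "assumption_U M Q \<eta> v w \<longleftrightarrow>
     prob_space Q \<and>
     (\<forall>k. \<forall>j\<in>{1..batch_size k}.
        v k j \<in> borel_measurable Q \<and> v k j \<in> space Q \<rightarrow> sphere 0 \<eta> \<and>
        distr Q borel (v k j) = uniform_sphere \<eta> \<and>
        w k j \<in> measurable Q M \<and> distr Q M (w k j) = M) \<and>
     prob_space.indep_sets Q (draw_events M Q v w) draws"

definition start_index :: "real \<Rightarrow> nat \<Rightarrow> nat" where
  "start_index lam K = nat \<lceil>lam * real K\<rceil>"

definition output_index ::
    "'w measure \<Rightarrow> 'q measure \<Rightarrow> (nat \<Rightarrow> nat \<Rightarrow> 'q \<Rightarrow> 'a::euclidean_space) \<Rightarrow>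
     (nat \<Rightarrow> nat \<Rightarrow> 'q \<Rightarrow> 'w) \<Rightarrow> real \<Rightarrow> nat \<Rightarrow> ('q \<Rightarrow> nat) \<Rightarrow> bool" where
  "output_index M Q v w lam K R \<longleftrightarrow>
     R \<in> measurable Q (count_space UNIV) \<and>
     distr Q (count_space UNIV) R = measure_pmf (pmf_of_set {start_index lam K..K}) \<and>
     prob_space.indep_set Q
       (sets (vimage_algebra (space Q) R (count_space UNIV)))
       (sigma_sets (space Q) (\<Union>d\<in>draws. draw_events M Q v w d))"

definition zo_gradient ::
    "('a::euclidean_space \<Rightarrow> 'b \<Rightarrow> 'w \<Rightarrow> real) \<Rightarrow> ('a \<Rightarrow> 'w \<Rightarrow> 'b) \<Rightarrow> real \<Rightarrow>
     'a \<Rightarrow> 'a \<Rightarrow> 'w \<Rightarrow> 'a" where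
  "zo_gradient f y \<eta> x v \<omega> =
     (real DIM('a) * (f (x + v) (y (x + v) \<omega>) \<omega> - f x (y x \<omega>) \<omega>) / (norm v * \<eta>)) *\<^sub>R v"

primrec zsol ::
    "'a::euclidean_space set \<Rightarrow> ('a \<Rightarrow> 'b \<Rightarrow> 'w \<Rightarrow> real) \<Rightarrow> ('a \<Rightarrow> 'w \<Rightarrow> 'b) \<Rightarrow> real \<Rightarrow> real \<Rightarrow>
     'a \<Rightarrow> (nat \<Rightarrow> nat \<Rightarrow> 'q \<Rightarrow> 'a) \<Rightarrow> (nat \<Rightarrow> nat \<Rightarrow> 'q \<Rightarrow> 'w) \<Rightarrow> nat \<Rightarrow> 'q \<Rightarrow> 'a" where
  "zsol X f y \<eta> \<gamma> x0 v w 0 q = x0"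
| "zsol X f y \<eta> \<gamma> x0 v w (Suc k) q =
     (let x = zsol X f y \<eta> \<gamma> x0 v w k q in
      closest_point X (x - \<gamma> *\<^sub>R ((1 / real (batch_size k)) *\<^sub>R
        (\<Sum>j = 1..batch_size k. zo_gradient f y \<eta> x (v k j q) (w k j q)))))"

definition iterations_needed :: "(nat \<Rightarrow> real) \<Rightarrow> real \<Rightarrow> nat" where
  "iterations_needed err \<epsilon> = (LEAST N. \<forall>K\<ge>N. err K \<le> \<epsilon>)"

definition samples_used :: "nat \<Rightarrow> nat" where
  "samples_used K = (\<Sum>k<K. batch_size k)"

text \<open>
  The constant hidden in the complexity bounds. A constant uniform in the dimension cannot be
  quantified existentially, because the dimension is a type; it is therefore given
  explicitly, as a function of \<open>lam\<close> and of a bound \<open>gap\<close> on the expected optimality gap at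
  the start of the output window.
\<close>

definition complexity_const :: "real \<Rightarrow> real \<Rightarrow> real" where
  "complexity_const lam gap =
     1 + 16 / (1 - lam) * (3 / 8 * (1 / 2 - ln lam) + gap + 2)"

end

theory Submission
  imports Defs
begin

text \<open>
  The ball average \<open>F\<^sub>\<eta>\<close> of an \<open>L\<close>-Lipschitz function \<open>F\<close> on \<open>\<real>\<^sup>n\<close> has the gradient
  \<open>(n/\<eta>) E[F(x + v) v/|v|]\<close> with \<open>v\<close> uniform on the sphere of radius \<open>\<eta>\<close>. This
  follows by replacing the indicator of the unit ball by a radial cutoff that decreases linearly
  on a shell of width \<open>\<delta>\<close>, integrating along lines, and letting \<open>\<delta>\<close> tend to \<open>0\<close>. As the
  formula for the gradient is itself \<open>nL/\<eta>\<close>-Lipschitz in \<open>x\<close>, the same computation gives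
  the descent inequality. The estimators of the scheme are thus unbiased with second moment at most
  \<open>n\<^sup>2 L0\<^sup>2\<close>, and given the past those of one batch are independent, so that the variance
  of their mean at step \<open>k\<close> is at most \<open>n\<^sup>2 L0\<^sup>2 / (k + 1)\<close>. Telescoping the projected
  descent inequality over the output window costs a harmonic sum that is at most \<open>1/2 - ln \<lambda>\<close>.
\<close>

section \<open>Gradient of the ball average of a Lipschitz function\<close>

text \<open>The objective is merely Lipschitz, so no derivative can fall on it, and a surface
  integral would call for a divergence theorem. The derivative is carried by the cutoff instead, and
  the sphere appears only as the image of the ball under \<open>sgn\<close>: sphere averages are
  ball integrals of functions constant on rays. The error of the first-order expansion is quadratic
  in the displacement with a constant free of \<delta>, so a single two-sided estimate survives the
  limit and serves both for the gradient and for the descent inequality. A second obstacle is that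
  the objective is controlled only on \<open>enlargement X \<eta>0\<close>, while translations need
  the whole space. Extending the integrand rather than its mean leaves the scheme unchanged, because
  all its evaluation points lie in that set. Conditional expectations are avoided: each iterate is a
  function of the draws of earlier batches, its joint law with a fresh sample is a product, and
  Fubini integrates the sample first.\<close>

lemma borel_measurable_sgn_euclidean [measurable]:
  "sgn \<in> borel_measurable (borel :: 'a::euclidean_space measure)"
  unfolding sgn_div_norm [abs_def] by measurable

lemma cball_measurable [measurable]: "cball c r \<in> sets (borel :: 'a::euclidean_space measure)"
  by simp

lemma borel_measurable_lipschitz_UNIV:
  fixes H :: "'a::euclidean_space \<Rightarrow> 'b::real_normed_vector"
  assumes "L-lipschitz_on UNIV H"
  shows "H \<in> borel_measurable borel"
  using assms by (intro borel_measurable_continuous_onI lipschitz_on_continuous_on)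

lemma integrable_lborel_bounded_support:
  fixes f :: "'a::euclidean_space \<Rightarrow> 'b::{banach, second_countable_topology}"
  assumes [measurable]: "f \<in> borel_measurable borel"
    and bd: "\<And>z. norm z \<le> r \<Longrightarrow> norm (f z) \<le> B"
    and supp: "\<And>z. norm z > r \<Longrightarrow> f z = 0"
  shows "integrable lborel f"
proof (rule Bochner_Integration.integrable_bound)
  show "integrable lborel (\<lambda>z. indicator (cball 0 r) z * \<bar>B\<bar>)"
    by (intro integrable_mult_left) (auto intro!: integrable_real_indicator emeasure_lborel_cball_finite)
  show "AE z in lborel. norm (f z) \<le> norm (indicator (cball 0 r) z * \<bar>B\<bar>)"
    using bd supp by (intro AE_I2) (force simp: indicator_def not_le)
qed auto

lemma integral_lborel_translate:
  fixes f :: "'a::euclidean_space \<Rightarrow> 'b::{banach, second_countable_topology}"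
  assumes [measurable]: "f \<in> borel_measurable borel"
  shows "(\<integral>z. f (c + z) \<partial>lborel) = (\<integral>z. f z \<partial>lborel)"
proof -
  have "(\<integral>z. f z \<partial>lborel) = (\<integral>z. f z \<partial>distr lborel borel ((+) c))"
    by (simp add: lborel_distr_plus)
  also have "\<dots> = (\<integral>z. f (c + z) \<partial>lborel)"
    by (rule integral_distr) auto
  finally show ?thesis ..
qed

section \<open>Thin shells inside the unit ball and their volume\<close>

definition unit_shell :: "real \<Rightarrow> 'a::real_normed_vector set" where
  "unit_shell \<delta> = {z. 1 - \<delta> < norm z \<and> norm z \<le> 1}"

lemma unit_shell_measurable [measurable]:
  "unit_shell \<delta> \<in> sets (borel :: 'a::euclidean_space measure)"
  unfolding unit_shell_def by measurable

text \<open>The dilation by \<open>s\<close> leaves \<open>sgn z\<close> unchanged and has Jacobian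
  \<open>s ^ DIM('a)\<close>. Together with the shell version below this takes the place of polar
  coordinates.\<close>

lemma integral_cball_radial:
  fixes g :: "'a::euclidean_space \<Rightarrow> real"
  assumes [measurable]: "g \<in> borel_measurable borel" and s: "0 < s"
  shows "(\<integral>z. indicator (cball 0 s) z * g (sgn z) \<partial>lborel)
       = s ^ DIM('a) * (\<integral>z. indicator (cball 0 1) z * g (sgn z) \<partial>lborel)"
proof -
  have [measurable]: "(\<lambda>z. indicator (cball 0 s) z * g (sgn z)) \<in> borel_measurable borel"
    by measurable
  have "(\<integral>z. indicator (cball 0 s) z * g (sgn z) \<partial>lborel)
      = (\<integral>z. indicator (cball 0 s) z * g (sgn z)
           \<partial>density (distr lborel borel (\<lambda>x. 0 + s *\<^sub>R x)) (\<lambda>_. ennreal (\<bar>s\<bar> ^ DIM('a))))"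
    using s by (subst lborel_affine [of s 0]) (auto simp: ennreal_power)
  also have "\<dots> = (\<integral>z. s ^ DIM('a) * (indicator (cball 0 s) z * g (sgn z))
           \<partial>(distr lborel borel (\<lambda>x. 0 + s *\<^sub>R x)))"
    using s by (subst integral_density) auto
  also have "\<dots> = (\<integral>z. s ^ DIM('a) * (indicator (cball 0 s) (s *\<^sub>R z) * g (sgn (s *\<^sub>R z))) \<partial>lborel)"
    using s by (subst integral_distr) auto
  also have "\<dots> = (\<integral>z. s ^ DIM('a) * (indicator (cball 0 1) z * g (sgn z)) \<partial>lborel)"
    using s by (intro Bochner_Integration.integral_cong) (auto simp: sgn_scaleR indicator_def)
  finally show ?thesis by simp
qed

lemma integral_unit_shell_radial:
  fixes g :: "'a::euclidean_space \<Rightarrow> real"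
  assumes g [measurable]: "g \<in> borel_measurable borel"
    and bd: "\<And>z. norm z \<le> 1 \<Longrightarrow> \<bar>g z\<bar> \<le> B" and \<delta>: "0 < \<delta>" "\<delta> < 1"
  shows "(\<integral>z. indicator (unit_shell \<delta>) z * g (sgn z) \<partial>lborel)
       = (1 - (1 - \<delta>) ^ DIM('a)) * (\<integral>z. indicator (cball 0 1) z * g (sgn z) \<partial>lborel)"
proof -
  have int: "integrable lborel (\<lambda>z. indicator (cball 0 s) z * g (sgn z))" for s
    using bd [of "sgn _"]
    by (intro integrable_lborel_bounded_support [where r = s and B = "\<bar>B\<bar>"])
       (auto simp: indicator_def norm_sgn intro: order_trans [OF _ abs_ge_self])
  \<comment> \<open>The shell is open towards the origin, which makes it exactly a difference of two
    closed balls.\<close>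
  have "(\<integral>z. indicator (unit_shell \<delta>) z * g (sgn z) \<partial>lborel)
      = (\<integral>z. indicator (cball 0 1) z * g (sgn z) - indicator (cball 0 (1 - \<delta>)) z * g (sgn z) \<partial>lborel)"
    using \<delta> by (intro Bochner_Integration.integral_cong) (auto simp: indicator_def unit_shell_def)
  also have "\<dots> = (\<integral>z. indicator (cball 0 1) z * g (sgn z) \<partial>lborel)
      - (1 - \<delta>) ^ DIM('a) * (\<integral>z. indicator (cball 0 1) z * g (sgn z) \<partial>lborel)"
    using \<delta> by (subst Bochner_Integration.integral_diff [OF int int], subst (2) integral_cball_radial) auto
  finally show ?thesis by (simp add: algebra_simps)
qed

lemma measure_unit_shell:
  assumes "0 < \<delta>" "\<delta> < 1"
  shows "measure lborel (unit_shell \<delta> :: 'a set)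
       = (1 - (1 - \<delta>) ^ DIM('a)) * measure lborel (cball (0::'a::euclidean_space) 1)"
  using integral_unit_shell_radial [of "\<lambda>_::'a. 1" 1 \<delta>] assms
  by simp

text \<open>Linear in \<delta> by Bernoulli, which is what cancels the factor
  \<open>1 / \<delta>\<close> of \<open>shell_field\<close>.\<close>

lemma measure_unit_shell_le:
  fixes \<delta> :: real
  assumes "0 < \<delta>" "\<delta> < 1"
  shows "measure lborel (unit_shell \<delta> :: 'a set)
       \<le> DIM('a) * \<delta> * measure lborel (cball (0::'a::euclidean_space) 1)"
proof -
  have "1 - real DIM('a) * \<delta> \<le> (1 - \<delta>) ^ DIM('a)"
    using Bernoulli_inequality [of "-\<delta>" "DIM('a)"] assms by simp
  then show ?thesis
    unfolding measure_unit_shell [OF assms, where 'a = 'a] by (intro mult_right_mono) auto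
qed

section \<open>A radial cutoff and its increments along lines\<close>

definition cutoff :: "real \<Rightarrow> 'a::real_normed_vector \<Rightarrow> real" where
  "cutoff \<delta> z = min 1 (max 0 ((1 - norm z) / \<delta>))"

text \<open>Minus the gradient of \<open>cutoff \<delta>\<close>, away from the two spheres bounding the shell.\<close>

definition shell_field :: "real \<Rightarrow> 'a::euclidean_space \<Rightarrow> 'a" where
  "shell_field \<delta> z = (indicator (unit_shell \<delta>) z / \<delta>) *\<^sub>R sgn z"

lemma cutoff_measurable [measurable]: "cutoff \<delta> \<in> borel_measurable (borel :: 'a::euclidean_space measure)"
  unfolding cutoff_def [abs_def] by measurable

lemma shell_field_measurable [measurable]: "shell_field \<delta> \<in> borel_measurable borel"
  unfolding shell_field_def [abs_def] by measurable

text \<open>Squaring gives a quadratic equation in \<open>t\<close> with leading coefficient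
  \<open>h \<bullet> h\<close>. The roots are the exceptional points at which a line meets a kink of
  the cutoff.\<close>

lemma finite_line_sphere:
  fixes z h :: "'a::real_inner"
  assumes "h \<noteq> 0"
  shows "finite {t::real. norm (z - t *\<^sub>R h) = c}"
proof -
  have "{t. norm (z - t *\<^sub>R h) = c} \<subseteq> {t. poly [:z \<bullet> z - c\<^sup>2, - 2 * (z \<bullet> h), h \<bullet> h:] t = 0}"
  proof clarify
    fix t assume "c = norm (z - t *\<^sub>R h)"
    then have "c\<^sup>2 = (z - t *\<^sub>R h) \<bullet> (z - t *\<^sub>R h)"
      by (simp add: power2_norm_eq_inner)
    then show "poly [:z \<bullet> z - (norm (z - t *\<^sub>R h))\<^sup>2, - 2 * (z \<bullet> h), h \<bullet> h:] t = 0"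
      by (simp add: power2_norm_eq_inner inner_diff_left inner_diff_right inner_commute algebra_simps)
  qed
  moreover have "finite {t. poly [:z \<bullet> z - c\<^sup>2, - 2 * (z \<bullet> h), h \<bullet> h:] t = 0}"
    using assms by (intro poly_roots_finite) simp
  ultimately show ?thesis by (rule finite_subset)
qed

lemma cutoff_has_derivative_along_line:
  fixes z h :: "'a::euclidean_space"
  assumes \<delta>: "0 < \<delta>" "\<delta> < 1" and t: "norm (z - t *\<^sub>R h) \<noteq> 1" "norm (z - t *\<^sub>R h) \<noteq> 1 - \<delta>"
  shows "((\<lambda>t. cutoff \<delta> (z - t *\<^sub>R h)) has_real_derivative shell_field \<delta> (z - t *\<^sub>R h) \<bullet> h) (at t)"
proof -
  let ?r = "\<lambda>t. norm (z - t *\<^sub>R h)"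
  have op: "open {t. ?r t < c}" "open {t. c < ?r t}" for c
    by (intro open_Collect_less continuous_intros)+
  consider "?r t < 1 - \<delta>" | "?r t > 1" | "1 - \<delta> < ?r t" "?r t < 1" using t by linarith
  then show ?thesis
  proof cases
    case 1
    have "((\<lambda>t. 1) has_real_derivative 0) (at t)" by simp
    then have "((\<lambda>t. cutoff \<delta> (z - t *\<^sub>R h)) has_real_derivative 0) (at t)"
      by (rule has_field_derivative_transform_within_open [where S = "{t. ?r t < 1 - \<delta>}"])
         (rule op, use 1 \<delta> in \<open>auto simp: cutoff_def field_simps\<close>)
    then show ?thesis using 1 by (simp add: shell_field_def unit_shell_def)
  next
    case 2
    have "((\<lambda>t. 0) has_real_derivative 0) (at t)" by simp
    then have "((\<lambda>t. cutoff \<delta> (z - t *\<^sub>R h)) has_real_derivative 0) (at t)"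
      by (rule has_field_derivative_transform_within_open [where S = "{t. ?r t > 1}"])
         (rule op, use 2 \<delta> in \<open>auto simp: cutoff_def field_simps max_def min_def\<close>)
    then show ?thesis using 2 by (simp add: shell_field_def unit_shell_def)
  next
    case 3
    \<comment> \<open>The inner radius \<open>1 - \<delta>\<close> is positive, so the shell misses
      the only point where the norm is not differentiable.\<close>
    then have nz: "z - t *\<^sub>R h \<noteq> 0" using \<delta> by auto
    have d: "(?r has_derivative (\<lambda>s. (- (s *\<^sub>R h)) \<bullet> sgn (z - t *\<^sub>R h))) (at t)"
      by (rule has_derivative_compose [where f = "\<lambda>t. z - t *\<^sub>R h", OF _ has_derivative_norm [OF nz]])
         (auto intro!: derivative_eq_intros)
    have "(?r has_real_derivative (- (h \<bullet> sgn (z - t *\<^sub>R h)))) (at t)"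
      unfolding has_field_derivative_def
      by (rule has_derivative_eq_rhs [OF d]) (auto simp: fun_eq_iff)
    then have "((\<lambda>t. (1 - ?r t) / \<delta>) has_real_derivative (h \<bullet> sgn (z - t *\<^sub>R h)) / \<delta>) (at t)"
      using \<delta> by (auto intro!: derivative_eq_intros)
    then have "((\<lambda>t. cutoff \<delta> (z - t *\<^sub>R h)) has_real_derivative (h \<bullet> sgn (z - t *\<^sub>R h)) / \<delta>) (at t)"
      by (rule has_field_derivative_transform_within_open [where S = "{t. ?r t < 1} \<inter> {t. 1 - \<delta> < ?r t}"])
         (intro open_Int op, use 3 \<delta> in \<open>auto simp: cutoff_def field_simps\<close>)
    then show ?thesis using 3 by (simp add: shell_field_def unit_shell_def inner_commute)
  qed
qed

lemma shell_field_le: "0 < \<delta> \<Longrightarrow> norm (shell_field \<delta> z) \<le> indicator (unit_shell \<delta>) z / \<delta>"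
  by (auto simp: shell_field_def norm_sgn indicator_def)

lemma shell_field_outside: "norm z > 1 \<Longrightarrow> shell_field \<delta> z = 0"
  by (simp add: shell_field_def unit_shell_def)

text \<open>The cutoff is continuous along the segment and differentiable off finitely many points,
  so its increment from \<open>z\<close> to \<open>z - h\<close> is the integral of its derivative.
  The minus sign in \<open>z - t *\<^sub>R h\<close> cancels the one in
  \<open>shell_field\<close>.\<close>

lemma integral_shell_field_along_line:
  fixes z h :: "'a::euclidean_space"
  assumes \<delta>: "0 < \<delta>" "\<delta> < 1"
  shows "(\<integral>t. indicator {0..1} t * (shell_field \<delta> (z - t *\<^sub>R h) \<bullet> h) \<partial>lborel)
       = cutoff \<delta> (z - h) - cutoff \<delta> z"
proof (cases "h = 0")
  case False
  let ?S = "{t. norm (z - t *\<^sub>R h) = 1} \<union> {t. norm (z - t *\<^sub>R h) = 1 - \<delta>}"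
  let ?g = "\<lambda>t. shell_field \<delta> (z - t *\<^sub>R h) \<bullet> h"
  have "(?g has_integral (cutoff \<delta> (z - 1 *\<^sub>R h) - cutoff \<delta> (z - 0 *\<^sub>R h))) {0..1}"
  proof (rule fundamental_theorem_of_calculus_strong [of ?S])
    show "finite ?S" using False by (auto intro: finite_line_sphere)
    show "continuous_on {0..1} (\<lambda>t. cutoff \<delta> (z - t *\<^sub>R h))"
      unfolding cutoff_def using \<delta> by (intro continuous_intros) auto
  qed (auto simp: has_real_derivative_iff_has_vector_derivative [symmetric] \<delta>
            intro!: cutoff_has_derivative_along_line)
  then have "integral {0..1} ?g = cutoff \<delta> (z - h) - cutoff \<delta> z"
    by (simp add: integral_unique)
  moreover have "set_integrable lborel {0..1} ?g"
    unfolding set_integrable_def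
  proof (rule integrable_lborel_bounded_support [where r = 1 and B = "norm h / \<delta>"])
    fix t :: real
    have "norm (?g t) \<le> norm (shell_field \<delta> (z - t *\<^sub>R h)) * norm h"
      by (simp add: Cauchy_Schwarz_ineq2)
    also have "\<dots> \<le> (1 / \<delta>) * norm h"
      using order_trans [OF shell_field_le [OF \<delta>(1)], of "z - t *\<^sub>R h" "1/\<delta>"] \<delta>
      by (intro mult_right_mono) (auto simp: indicator_def)
    finally show "norm (indicator {0..1} t *\<^sub>R ?g t) \<le> norm h / \<delta>"
      using \<delta> by (auto simp: indicator_def)
  qed (auto simp: indicator_def)
  ultimately show ?thesis
    using set_borel_integral_eq_integral(2) [of "{0..1}" ?g] by (simp add: set_lebesgue_integral_def)
qed simp

section \<open>The averaged increment up to a quadratic error\<close>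

lemma integrable_lborel_translate:
  fixes f :: "'a::euclidean_space \<Rightarrow> 'b::{banach, second_countable_topology}"
  assumes "integrable lborel f"
  shows "integrable lborel (\<lambda>z. f (c + z))"
proof -
  have [measurable]: "f \<in> borel_measurable borel"
    using borel_measurable_integrable [OF assms] by simp
  have "integrable (distr lborel borel ((+) c)) f" using assms by (simp add: lborel_distr_plus)
  then show ?thesis by (subst (asm) integrable_distr_eq) auto
qed

lemma lipschitz_UNIV_bound:
  fixes H :: "'a::real_normed_vector \<Rightarrow> real"
  assumes "L-lipschitz_on UNIV H"
  shows "\<bar>H (z + u) - H z\<bar> \<le> L * norm u"
  using lipschitz_onD [OF assms, of "z + u" z] by (simp add: dist_norm)

lemma lipschitz_UNIV_growth:
  fixes H :: "'a::real_normed_vector \<Rightarrow> real"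
  assumes "L-lipschitz_on UNIV H" "norm z \<le> r"
  shows "\<bar>H z\<bar> \<le> \<bar>H 0\<bar> + L * r"
proof -
  have "L * norm z \<le> L * r"
    using assms lipschitz_on_nonneg [OF assms(1)] by (intro mult_left_mono)
  then show ?thesis
    using lipschitz_UNIV_bound [OF assms(1), of 0 z] by simp
qed

text \<open>A translation moves the increment from \<open>H\<close> to the cutoff, where it becomes
  a line integral; Fubini and translating back by \<open>t *\<^sub>R h\<close> leave the average
  over \<open>t\<close> in [0,1] of the shell integral with \<open>H\<close> shifted by
  \<open>t *\<^sub>R h\<close>. Undoing the shift changes \<open>H\<close> by at most
  \<open>t * L * norm h\<close>, and integrating \<open>t\<close> gives the factor 1/2.\<close>

lemma cutoff_smoothing_expansion:
  fixes H :: "'a::euclidean_space \<Rightarrow> real" and h :: 'a and L :: real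
  assumes H: "L-lipschitz_on UNIV H" and \<delta>: "0 < \<delta>" "\<delta> < 1"
  shows "\<bar>(\<integral>z. (H (z + h) - H z) * cutoff \<delta> z \<partial>lborel) - (\<integral>z. H z * (shell_field \<delta> z \<bullet> h) \<partial>lborel)\<bar>
       \<le> DIM('a) * L / 2 * (norm h)\<^sup>2 * measure lborel (cball (0::'a) 1)"
proof -
  note [measurable] = borel_measurable_lipschitz_UNIV [OF H]
  have L: "0 \<le> L" using H by (rule lipschitz_on_nonneg)
  let ?\<kappa> = "shell_field \<delta> :: 'a \<Rightarrow> 'a" and ?V = "measure lborel (cball (0::'a) 1)"
  let ?P = "\<lambda>z t. indicator {0..1::real} t * (H z * (?\<kappa> (z - t *\<^sub>R h) \<bullet> h))"
  have \<kappa>: "\<bar>?\<kappa> z \<bullet> h\<bar> \<le> indicator (unit_shell \<delta>) z / \<delta> * norm h" for z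
    using Cauchy_Schwarz_ineq2 [of "?\<kappa> z" h] mult_right_mono [OF shell_field_le [OF \<delta>(1)] norm_ge_zero, of z h]
    by linarith
  have \<kappa>1: "\<bar>?\<kappa> z \<bullet> h\<bar> \<le> norm h / \<delta>" for z
    using order_trans [OF \<kappa>, of z "norm h / \<delta>"] \<delta> by (auto simp: indicator_def)
  have cut: "\<bar>cutoff \<delta> z\<bar> \<le> 1" for z :: 'a by (auto simp: cutoff_def)
  have cut0: "cutoff \<delta> z = 0" if "norm z > 1" for z :: 'a
    using that \<delta> by (auto simp: cutoff_def max_def field_simps)
  have intHc: "integrable lborel (\<lambda>z. H z * cutoff \<delta> (z - a))" for a
  proof (rule integrable_lborel_bounded_support [where r = "1 + norm a" and B = "(\<bar>H 0\<bar> + L * (1 + norm a)) * 1"])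
    show "norm (H z * cutoff \<delta> (z - a)) \<le> (\<bar>H 0\<bar> + L * (1 + norm a)) * 1" if "norm z \<le> 1 + norm a" for z
      unfolding real_norm_def abs_mult using L
      by (intro mult_mono lipschitz_UNIV_growth [OF H that] cut) auto
    show "H z * cutoff \<delta> (z - a) = 0" if "norm z > 1 + norm a" for z
      using cut0 [of "z - a"] that norm_triangle_ineq2 [of z a] by simp
  qed measurable
  have intH\<kappa>: "integrable lborel (\<lambda>z. H (z + a) * (?\<kappa> z \<bullet> h))" for a
  proof (rule integrable_lborel_bounded_support [where r = 1 and B = "(\<bar>H 0\<bar> + L * (1 + norm a)) * (norm h / \<delta>)"])
    show "norm (H (z + a) * (?\<kappa> z \<bullet> h)) \<le> (\<bar>H 0\<bar> + L * (1 + norm a)) * (norm h / \<delta>)" if "norm z \<le> 1" for z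
      unfolding real_norm_def abs_mult using L that norm_triangle_ineq [of z a]
      by (intro mult_mono lipschitz_UNIV_growth [OF H] \<kappa>1) auto
  qed (measurable, simp add: shell_field_outside)
  \<comment> \<open>\<open>t\<close> ranges over [0,1], and the field then vanishes unless
    \<open>norm z \<le> 1 + norm h\<close>; the norm of a pair is at most the sum of the two norms,
    whence the radius \<open>2 + norm h\<close>.\<close>
  have intP: "integrable (lborel \<Otimes>\<^sub>M lborel) (\<lambda>(z, t). ?P z t)"
    unfolding lborel_prod
  proof (rule integrable_lborel_bounded_support
      [where r = "2 + norm h" and B = "1 * ((\<bar>H 0\<bar> + L * (2 + norm h)) * (norm h / \<delta>))"])
    show "(\<lambda>(z, t). ?P z t) \<in> borel_measurable borel"
      unfolding borel_prod [symmetric] by measurable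
    show "norm (case zt of (z, t) \<Rightarrow> ?P z t) \<le> 1 * ((\<bar>H 0\<bar> + L * (2 + norm h)) * (norm h / \<delta>))"
      if "norm zt \<le> 2 + norm h" for zt :: "'a \<times> real"
    proof -
      obtain z t where zt: "zt = (z, t)" by (cases zt)
      have "norm z \<le> 2 + norm h" using that norm_fst_le [of z t] by (simp add: zt)
      then show ?thesis
        unfolding zt prod.case real_norm_def abs_mult using L \<delta>
        by (intro mult_mono lipschitz_UNIV_growth [OF H] \<kappa>1) (auto simp: indicator_def)
    qed
    show "(case zt of (z, t) \<Rightarrow> ?P z t) = 0" if "norm zt > 2 + norm h" for zt :: "'a \<times> real"
    proof -
      obtain z t where zt: "zt = (z, t)" by (cases zt)
      have "norm zt \<le> norm z + norm t" using norm_Pair_le [of z t] by (simp add: zt)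
      moreover have "norm (z - t *\<^sub>R h) > 1" if "0 \<le> t" "t \<le> 1"
      proof -
        have "norm (t *\<^sub>R h) \<le> norm h" using that by (simp add: mult_left_le_one_le)
        then show ?thesis
          using norm_triangle_ineq2 [of z "t *\<^sub>R h"] \<open>norm zt > 2 + norm h\<close> \<open>norm zt \<le> norm z + norm t\<close> that
          by simp
      qed
      ultimately show ?thesis using shell_field_outside [of "z - t *\<^sub>R h"] by (auto simp: zt indicator_def)
    qed
  qed
  let ?c = "\<integral>z. H z * (?\<kappa> z \<bullet> h) \<partial>lborel"
  let ?m = "\<lambda>t. \<integral>z. H (z + t *\<^sub>R h) * (?\<kappa> z \<bullet> h) \<partial>lborel"
  \<comment> \<open>Writing \<open>z\<close> as \<open>z + h - h\<close> in the cutoff displays the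
    first term as a translate of \<open>H z * cutoff \<delta> (z - h)\<close>.\<close>
  have "(\<integral>z. (H (z + h) - H z) * cutoff \<delta> z \<partial>lborel)
      = (\<integral>z. H (z + h) * cutoff \<delta> (z + h - h) - H z * cutoff \<delta> (z - 0) \<partial>lborel)"
    by (simp add: algebra_simps)
  also have "\<dots> = (\<integral>z. H (z + h) * cutoff \<delta> (z + h - h) \<partial>lborel) - (\<integral>z. H z * cutoff \<delta> (z - 0) \<partial>lborel)"
    using integrable_lborel_translate [OF intHc [of h], of h]
    by (intro Bochner_Integration.integral_diff intHc) (simp add: add.commute)
  also have "(\<integral>z. H (z + h) * cutoff \<delta> (z + h - h) \<partial>lborel) = (\<integral>z. H z * cutoff \<delta> (z - h) \<partial>lborel)"
    using integral_lborel_translate [of "\<lambda>z. H z * cutoff \<delta> (z - h)" h] by (simp add: add.commute)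
  also have "(\<integral>z. H z * cutoff \<delta> (z - h) \<partial>lborel) - (\<integral>z. H z * cutoff \<delta> (z - 0) \<partial>lborel)
      = (\<integral>z. H z * (cutoff \<delta> (z - h) - cutoff \<delta> z) \<partial>lborel)"
    using Bochner_Integration.integral_diff [OF intHc [of h] intHc [of 0]] by (simp add: algebra_simps)
  also have "\<dots> = (\<integral>z. (\<integral>t. ?P z t \<partial>lborel) \<partial>lborel)"
  proof (intro Bochner_Integration.integral_cong refl)
    fix z
    have "(\<integral>t. ?P z t \<partial>lborel) = H z * (\<integral>t. indicator {0..1} t * (?\<kappa> (z - t *\<^sub>R h) \<bullet> h) \<partial>lborel)"
      by (subst integral_mult_right_zero [symmetric]) (simp add: ac_simps)
    then show "H z * (cutoff \<delta> (z - h) - cutoff \<delta> z) = (\<integral>t. ?P z t \<partial>lborel)"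
      by (simp only: integral_shell_field_along_line [OF \<delta>])
  qed
  also have "\<dots> = (\<integral>t. (\<integral>z. ?P z t \<partial>lborel) \<partial>lborel)"
    by (rule lborel_pair.Fubini_integral [OF intP, symmetric])
  also have "\<dots> = (\<integral>t. indicator {0..1} t * ?m t \<partial>lborel)"
  proof (intro Bochner_Integration.integral_cong refl)
    fix t :: real
    have "(\<integral>z. ?P z t \<partial>lborel) = indicator {0..1} t * (\<integral>z. H z * (?\<kappa> (z - t *\<^sub>R h) \<bullet> h) \<partial>lborel)"
      by simp
    then show "(\<integral>z. ?P z t \<partial>lborel) = indicator {0..1} t * ?m t"
      using integral_lborel_translate [of "\<lambda>z. H z * (?\<kappa> (z - t *\<^sub>R h) \<bullet> h)" "t *\<^sub>R h"]
      by (simp add: add.commute)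
  qed
  finally have eq: "(\<integral>z. (H (z + h) - H z) * cutoff \<delta> z \<partial>lborel) = (\<integral>t. indicator {0..1} t * ?m t \<partial>lborel)" .
  \<comment> \<open>The field contributes at most \<open>norm h / \<delta>\<close>, and only on the
    shell, whose volume is at most \<open>DIM('a) * \<delta> * ?V\<close>; so \<delta> drops out of
    the bound.\<close>
  have dev: "\<bar>?m t - ?c\<bar> \<le> t * (L * (norm h)\<^sup>2 * (DIM('a) * ?V))" if t: "0 \<le> t" for t
  proof -
    have "?m t - ?c = (\<integral>z. (H (z + t *\<^sub>R h) - H z) * (?\<kappa> z \<bullet> h) \<partial>lborel)"
      using Bochner_Integration.integral_diff [OF intH\<kappa> [of "t *\<^sub>R h"] intH\<kappa> [of 0]] by (simp add: algebra_simps)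
    also have "\<bar>\<dots>\<bar> \<le> (\<integral>z. t * L * (norm h)\<^sup>2 / \<delta> * indicator (unit_shell \<delta>) (z::'a) \<partial>lborel)"
    proof (rule integral_abs_bound_integral)
      show "integrable lborel (\<lambda>z. (H (z + t *\<^sub>R h) - H z) * (?\<kappa> z \<bullet> h))"
        using Bochner_Integration.integrable_diff [OF intH\<kappa> [of "t *\<^sub>R h"] intH\<kappa> [of 0]] by (simp add: algebra_simps)
      show "integrable lborel (\<lambda>z::'a. t * L * (norm h)\<^sup>2 / \<delta> * indicator (unit_shell \<delta>) z)"
        by (intro integrable_lborel_bounded_support [where r = 1 and B = "\<bar>t * L * (norm h)\<^sup>2 / \<delta>\<bar>"])
           (auto simp: indicator_def unit_shell_def)
      fix z
      have "\<bar>(H (z + t *\<^sub>R h) - H z) * (?\<kappa> z \<bullet> h)\<bar> \<le> (L * norm (t *\<^sub>R h)) * (indicator (unit_shell \<delta>) z / \<delta> * norm h)"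
        unfolding abs_mult using L by (intro mult_mono lipschitz_UNIV_bound [OF H] \<kappa>) auto
      then show "\<bar>(H (z + t *\<^sub>R h) - H z) * (?\<kappa> z \<bullet> h)\<bar> \<le> t * L * (norm h)\<^sup>2 / \<delta> * indicator (unit_shell \<delta>) z"
        using t by (simp add: power2_eq_square ac_simps)
    qed
    also have "\<dots> = t * L * (norm h)\<^sup>2 / \<delta> * measure lborel (unit_shell \<delta> :: 'a set)"
      by simp
    also have "\<dots> \<le> t * L * (norm h)\<^sup>2 / \<delta> * (DIM('a) * \<delta> * ?V)"
      using measure_unit_shell_le [OF \<delta>, where 'a = 'a] t L \<delta> by (intro mult_left_mono) auto
    finally show ?thesis using \<delta> by (simp add: ac_simps)
  qed
  have intm: "integrable lborel (\<lambda>t. indicator {0..1} t * ?m t)"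
  proof (rule integrable_lborel_bounded_support [where r = 1 and B = "\<bar>?c\<bar> + L * (norm h)\<^sup>2 * (DIM('a) * ?V)"])
    show "norm (indicator {0..1} t * ?m t) \<le> \<bar>?c\<bar> + L * (norm h)\<^sup>2 * (DIM('a) * ?V)" for t
    proof (cases "0 \<le> t \<and> t \<le> 1")
      case True
      have "t * (L * (norm h)\<^sup>2 * (DIM('a) * ?V)) \<le> L * (norm h)\<^sup>2 * (DIM('a) * ?V)"
        using True L by (intro mult_left_le_one_le) auto
      then show ?thesis using dev [of t] True by simp
    qed (use L in \<open>auto simp: indicator_def\<close>)
  qed (measurable, auto simp: indicator_def)
  have ind: "set_integrable lborel {0..1} (\<lambda>t::real. t)"
    by (intro borel_integrable_atLeastAtMost') (auto intro: continuous_intros)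
  have int2: "(\<integral>t. indicator {0..1} t * t \<partial>lborel) = (1/2 :: real)"
    using set_borel_integral_eq_integral(2) [OF ind] integral_unique [OF ident_has_integral [of 0 "1::real"]]
    by (simp add: set_lebesgue_integral_def)
  have halve: "1 / 2 * (L * a * (d * b)) = d * L / 2 * a * b" for a b d :: real
    by (simp add: field_simps)
  have int1: "integrable lborel (\<lambda>t::real. indicator {0..1} t * ?c)"
    by (intro integrable_mult_left) simp
  have "(\<integral>t. indicator {0..1::real} t * ?m t \<partial>lborel) - ?c = (\<integral>t. indicator {0..1} t * ?m t - indicator {0..1} t * ?c \<partial>lborel)"
    using Bochner_Integration.integral_diff [OF intm int1] by simp
  moreover have "\<bar>\<integral>t. indicator {0..1} t * ?m t - indicator {0..1} t * ?c \<partial>lborel\<bar>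
      \<le> (\<integral>t. indicator {0..1} t * t * (L * (norm h)\<^sup>2 * (DIM('a) * ?V)) \<partial>lborel)"
  proof (rule integral_abs_bound_integral)
    show "\<bar>indicator {0..1} t * ?m t - indicator {0..1} t * ?c\<bar> \<le> indicator {0..1} t * t * (L * (norm h)\<^sup>2 * (DIM('a) * ?V))" for t
      using dev [of t] by (auto simp: indicator_def)
  qed (intro Bochner_Integration.integrable_diff intm int1 integrable_mult_left ind [unfolded set_integrable_def real_scaleR_def])+
  moreover have "(\<integral>t. indicator {0..1} t * t * (L * (norm h)\<^sup>2 * (DIM('a) * ?V)) \<partial>lborel) = DIM('a) * L / 2 * (norm h)\<^sup>2 * ?V"
    unfolding integral_mult_left_zero int2 by (rule halve)
  ultimately show ?thesis unfolding eq by linarith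
qed

text \<open>Two replacements lead from the cutoff to the ball and the sphere, each with an error
  proportional to \<delta>: the cutoff differs from the indicator of the ball only on the shell, and
  on the shell \<open>H z\<close> may be traded for \<open>H (sgn z)\<close>. The radial integral
  over the shell divided by \<delta> then carries the factor \<open>?a \<delta>\<close>, whose limit
  is the dimension.\<close>

lemma unit_ball_smoothing_expansion:
  fixes H :: "'a::euclidean_space \<Rightarrow> real" and h :: 'a and L :: real
  assumes H: "L-lipschitz_on UNIV H"
  shows "\<bar>(\<integral>z. indicator (cball 0 1) z * (H (z + h) - H z) \<partial>lborel)
          - DIM('a) * (\<integral>z. indicator (cball 0 1) z * (H (sgn z) * (sgn z \<bullet> h)) \<partial>lborel)\<bar>
       \<le> DIM('a) * L / 2 * (norm h)\<^sup>2 * measure lborel (cball (0::'a) 1)"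
proof -
  note [measurable] = borel_measurable_lipschitz_UNIV [OF H]
  have L: "0 \<le> L" using H by (rule lipschitz_on_nonneg)
  let ?V = "measure lborel (cball (0::'a) 1)"
  let ?D = "\<integral>z. indicator (cball 0 1) z * (H (z + h) - H z) \<partial>lborel"
  let ?S = "\<integral>z. indicator (cball 0 1) z * (H (sgn z) * (sgn z \<bullet> h)) \<partial>lborel"
  let ?a = "\<lambda>\<delta>::real. (1 - (1 - \<delta>) ^ DIM('a)) / \<delta>"
  have bdh: "\<bar>H (z + h) - H z\<bar> \<le> L * norm h" for z by (rule lipschitz_UNIV_bound [OF H])
  have bdS: "\<bar>H z * (z \<bullet> h)\<bar> \<le> (\<bar>H 0\<bar> + L * 1) * norm h" if "norm z \<le> 1" for z
  proof -
    have "\<bar>z \<bullet> h\<bar> \<le> norm h"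
      using Cauchy_Schwarz_ineq2 [of z h] mult_right_mono [OF that norm_ge_zero [of h]] by simp
    then show ?thesis
      unfolding abs_mult using L by (intro mult_mono lipschitz_UNIV_growth [OF H that]) auto
  qed
  have bound: "\<bar>?D - ?a \<delta> * ?S\<bar> \<le> DIM('a) * L / 2 * (norm h)\<^sup>2 * ?V + 2 * (L * norm h * (DIM('a) * \<delta> * ?V))"
    if \<delta>: "0 < \<delta>" "\<delta> < 1" for \<delta> :: real
  proof -
    have ish: "integrable lborel (\<lambda>z::'a. c * indicator (unit_shell \<delta>) z :: real)" for c
      by (intro integrable_lborel_bounded_support [where r = 1 and B = "\<bar>c\<bar>"])
         (auto simp: indicator_def unit_shell_def)
    let ?D\<delta> = "\<integral>z. (H (z + h) - H z) * cutoff \<delta> z \<partial>lborel"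
    let ?T = "\<integral>z. H z * (shell_field \<delta> z \<bullet> h) \<partial>lborel"
    have cut: "\<bar>cutoff \<delta> z\<bar> \<le> 1" for z :: 'a by (auto simp: cutoff_def)
    have cut0: "cutoff \<delta> z = 0" if "norm z > 1" for z :: 'a
      using that \<delta> by (auto simp: cutoff_def max_def field_simps)
    have cut1: "cutoff \<delta> z = 1" if "norm z \<le> 1 - \<delta>" for z :: 'a
      using that \<delta> by (auto simp: cutoff_def max_def min_def field_simps)
    have shell: "measure lborel (unit_shell \<delta> :: 'a set) \<le> DIM('a) * \<delta> * ?V"
      by (rule measure_unit_shell_le [OF \<delta>])
    have i1: "integrable lborel (\<lambda>z. indicator (cball 0 1) z * (H (z + h) - H z))"
      using bdh L by (intro integrable_lborel_bounded_support [where r = 1 and B = "L * norm h"])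
        (auto simp: indicator_def)
    have i2: "integrable lborel (\<lambda>z. (H (z + h) - H z) * cutoff \<delta> z)"
    proof (rule integrable_lborel_bounded_support [where r = 1 and B = "L * norm h * 1"])
      show "norm ((H (z + h) - H z) * cutoff \<delta> z) \<le> L * norm h * 1" for z
        unfolding real_norm_def abs_mult using L by (intro mult_mono bdh cut) auto
    qed (use cut0 in auto)
    have "?D - ?D\<delta> = (\<integral>z. indicator (cball 0 1) z * (H (z + h) - H z) - (H (z + h) - H z) * cutoff \<delta> z \<partial>lborel)"
      using Bochner_Integration.integral_diff [OF i1 i2] by simp
    also have "\<bar>\<dots>\<bar> \<le> (\<integral>z. L * norm h * indicator (unit_shell \<delta>) (z::'a) \<partial>lborel)"
    proof (rule integral_abs_bound_integral [OF Bochner_Integration.integrable_diff [OF i1 i2] ish])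
      fix z :: 'a
      consider "norm z > 1" | "norm z \<le> 1 - \<delta>" | "z \<in> unit_shell \<delta>"
        unfolding unit_shell_def mem_Collect_eq by linarith
      then show "\<bar>indicator (cball 0 1) z * (H (z + h) - H z) - (H (z + h) - H z) * cutoff \<delta> z\<bar>
          \<le> L * norm h * indicator (unit_shell \<delta>) z"
      proof cases
        case 3
        have "\<bar>1 - cutoff \<delta> z\<bar> \<le> 1" by (auto simp: cutoff_def)
        with 3 have "\<bar>(H (z + h) - H z) * (1 - cutoff \<delta> z)\<bar> \<le> L * norm h * 1"
          unfolding abs_mult using L by (intro mult_mono bdh) auto
        with 3 show ?thesis by (simp add: unit_shell_def algebra_simps)
      qed (use \<delta> L in \<open>auto simp: cut0 cut1\<close>)
    qed
    also have "\<dots> \<le> L * norm h * (DIM('a) * \<delta> * ?V)"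
      using shell L by (simp add: mult_left_mono)
    finally have 1: "\<bar>?D - ?D\<delta>\<bar> \<le> L * norm h * (DIM('a) * \<delta> * ?V)" .
    have i3: "integrable lborel (\<lambda>z. H z * (shell_field \<delta> z \<bullet> h))"
    proof (rule integrable_lborel_bounded_support [where r = 1 and B = "(\<bar>H 0\<bar> + L * 1) * (1 / \<delta> * norm h)"])
      show "norm (H z * (shell_field \<delta> z \<bullet> h)) \<le> (\<bar>H 0\<bar> + L * 1) * (1 / \<delta> * norm h)" if "norm z \<le> 1" for z
      proof -
        have "\<bar>shell_field \<delta> z \<bullet> h\<bar> \<le> norm (shell_field \<delta> z) * norm h" by (rule Cauchy_Schwarz_ineq2)
        also have "\<dots> \<le> 1 / \<delta> * norm h"
          using order_trans [OF shell_field_le [OF \<delta>(1)], of z "1 / \<delta>"] \<delta>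
          by (intro mult_right_mono) (auto simp: indicator_def)
        finally show ?thesis
          unfolding real_norm_def abs_mult using L by (intro mult_mono lipschitz_UNIV_growth [OF H that]) auto
      qed
    qed (measurable, simp add: shell_field_outside)
    have i4: "integrable lborel (\<lambda>z. indicator (unit_shell \<delta>) z * (H (sgn z) * (sgn z \<bullet> h)))"
      using bdS [of "sgn _"] L
      by (intro integrable_lborel_bounded_support [where r = 1 and B = "(\<bar>H 0\<bar> + L * 1) * norm h"])
         (auto simp: indicator_def unit_shell_def norm_sgn)
    have "?a \<delta> * ?S = (\<integral>z. indicator (unit_shell \<delta>) z * (H (sgn z) * (sgn z \<bullet> h)) \<partial>lborel) / \<delta>"
      using bdS by (subst integral_unit_shell_radial [where g = "\<lambda>z. H z * (z \<bullet> h)", OF _ _ \<delta>]) auto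
    then have "?T - ?a \<delta> * ?S = (\<integral>z. H z * (shell_field \<delta> z \<bullet> h)
        - indicator (unit_shell \<delta>) z * (H (sgn z) * (sgn z \<bullet> h)) / \<delta> \<partial>lborel)"
      using Bochner_Integration.integral_diff [OF i3 integrable_divide [OF i4, of \<delta>]] by simp
    also have "\<bar>\<dots>\<bar> \<le> (\<integral>z. L * norm h * indicator (unit_shell \<delta>) (z::'a) \<partial>lborel)"
    proof (rule integral_abs_bound_integral [OF Bochner_Integration.integrable_diff [OF i3] ish])
      fix z :: 'a
      show "\<bar>H z * (shell_field \<delta> z \<bullet> h) - indicator (unit_shell \<delta>) z * (H (sgn z) * (sgn z \<bullet> h)) / \<delta>\<bar>
          \<le> L * norm h * indicator (unit_shell \<delta>) z"
      proof (cases "z \<in> unit_shell \<delta>")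
        case True
        then have z: "z \<noteq> 0" "1 - \<delta> < norm z" "norm z \<le> 1" using \<delta> by (auto simp: unit_shell_def)
        \<comment> \<open>A shell point is within \<delta> of its radial projection; this \<delta>
          offsets the \<open>1 / \<delta>\<close> of the field.\<close>
        have "z - sgn z = (norm z - 1) *\<^sub>R sgn z"
          using z by (simp add: sgn_div_norm algebra_simps)
        then have "norm (z - sgn z) \<le> \<delta>" using z by (simp add: norm_sgn)
        then have "\<bar>H z - H (sgn z)\<bar> \<le> L * \<delta>"
          using lipschitz_onD [OF H, of z "sgn z"] mult_left_mono [of "norm (z - sgn z)" \<delta> L] L
          by (simp add: dist_norm)
        moreover have "\<bar>sgn z \<bullet> h\<bar> \<le> norm h"
          using Cauchy_Schwarz_ineq2 [of "sgn z" h] z by (simp add: norm_sgn)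
        ultimately have "\<bar>(H z - H (sgn z)) * (sgn z \<bullet> h)\<bar> \<le> L * \<delta> * norm h"
          unfolding abs_mult using L \<delta> by (intro mult_mono) auto
        then have "\<bar>(H z - H (sgn z)) * (sgn z \<bullet> h) / \<delta>\<bar> \<le> L * norm h"
          using \<delta> by (simp add: abs_divide pos_divide_le_eq ac_simps)
        moreover have "H z * (shell_field \<delta> z \<bullet> h) - indicator (unit_shell \<delta>) z * (H (sgn z) * (sgn z \<bullet> h)) / \<delta>
            = (H z - H (sgn z)) * (sgn z \<bullet> h) / \<delta>"
          using True by (simp add: shell_field_def diff_divide_distrib left_diff_distrib)
        ultimately show ?thesis using True by simp
      qed (simp add: shell_field_def)
    qed (use i4 in auto)
    also have "\<dots> \<le> L * norm h * (DIM('a) * \<delta> * ?V)"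
      using shell L by (simp add: mult_left_mono)
    finally have 2: "\<bar>?T - ?a \<delta> * ?S\<bar> \<le> L * norm h * (DIM('a) * \<delta> * ?V)" .
    show ?thesis using 1 2 cutoff_smoothing_expansion [OF H \<delta>, of h] by linarith
  qed
  \<comment> \<open>\<open>?a\<close> is minus the difference quotient of
    \<open>(1 - \<delta>) ^ DIM('a)\<close> at 0.\<close>
  have "((\<lambda>\<delta>::real. (1 - \<delta>) ^ DIM('a)) has_real_derivative - real DIM('a)) (at 0)"
    by (auto intro!: derivative_eq_intros)
  then have "((\<lambda>\<delta>. ((1 - \<delta>) ^ DIM('a) - 1) / \<delta>) \<longlongrightarrow> - real DIM('a)) (at (0::real))"
    unfolding DERIV_def by simp
  then have "(?a \<longlongrightarrow> - (- real DIM('a))) (at 0)"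
    by (rule Lim_transform_eventually [OF tendsto_minus]) (simp add: minus_divide_left)
  then have a: "(?a \<longlongrightarrow> real DIM('a)) (at_right 0)"
    by (simp add: filterlim_at_split)
  have "((\<lambda>\<delta>. \<bar>?D - ?a \<delta> * ?S\<bar>) \<longlongrightarrow> \<bar>?D - DIM('a) * ?S\<bar>) (at_right 0)"
    by (intro tendsto_intros a)
  then have "\<bar>?D - DIM('a) * ?S\<bar> \<le> DIM('a) * L / 2 * (norm h)\<^sup>2 * ?V + 2 * (L * norm h * (real DIM('a) * 0 * ?V))"
  proof (rule tendsto_le [OF trivial_limit_at_right_real, rotated])
    show "((\<lambda>\<delta>::real. DIM('a) * L / 2 * (norm h)\<^sup>2 * ?V + 2 * (L * norm h * (DIM('a) * \<delta> * ?V)))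
      \<longlongrightarrow> DIM('a) * L / 2 * (norm h)\<^sup>2 * ?V + 2 * (L * norm h * (real DIM('a) * 0 * ?V))) (at_right 0)"
      by (intro tendsto_intros)
    show "\<forall>\<^sub>F \<delta> in at_right (0::real). \<bar>?D - ?a \<delta> * ?S\<bar>
      \<le> DIM('a) * L / 2 * (norm h)\<^sup>2 * ?V + 2 * (L * norm h * (DIM('a) * \<delta> * ?V))"
      by (rule eventually_at_rightI [of 0 1], rule bound) auto
  qed
  then show ?thesis by simp
qed

section \<open>The uniform law on the sphere and the gradient formula\<close>

lemma norm_scaled_le:
  fixes u :: "'a::real_normed_vector" and \<eta> :: real
  assumes "0 < \<eta>" "norm u \<le> 1"
  shows "norm (\<eta> *\<^sub>R u) \<le> \<eta>"
  using assms by simp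

lemma measure_unit_cball_pos: "0 < measure lborel (cball (0::'a::euclidean_space) 1)"
  by simp

lemma uniform_unit_cball_density:
  "uniform_measure lborel (cball (0::'a::euclidean_space) 1)
   = density lborel (\<lambda>u. ennreal (indicator (cball 0 1) u / measure lborel (cball (0::'a) 1)))"
proof -
  have e: "emeasure lborel (cball (0::'a) 1) = ennreal (measure lborel (cball (0::'a) 1))"
    using emeasure_lborel_cball_finite [of "0::'a" 1] by (intro emeasure_eq_ennreal_measure) auto
  show ?thesis
    unfolding uniform_measure_def e
    by (intro density_cong) (auto simp: indicator_def divide_ennreal ennreal_1 [symmetric] simp del: ennreal_1)
qed

lemma prob_space_uniform_unit_cball:
  "prob_space (uniform_measure lborel (cball (0::'a::euclidean_space) 1))"
proof (rule prob_space_uniform_measure)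
  have e: "emeasure lborel (cball (0::'a) 1) = ennreal (measure lborel (cball (0::'a) 1))"
    using emeasure_lborel_cball_finite [of "0::'a" 1] by (intro emeasure_eq_ennreal_measure) auto
  show "emeasure lborel (cball (0::'a) 1) \<noteq> 0"
    unfolding e using measure_unit_cball_pos [where 'a = 'a] by (simp del: content_cball_gt_0_iff)
  show "emeasure lborel (cball (0::'a) 1) \<noteq> \<infinity>"
    unfolding e by simp
qed

lemma sets_uniform_sphere [measurable_cong, simp]: "sets (uniform_sphere \<eta>) = sets borel"
  by (simp add: uniform_sphere_def)

lemma space_uniform_sphere [simp]: "space (uniform_sphere \<eta>) = UNIV"
  by (simp add: uniform_sphere_def)

lemma prob_space_uniform_sphere: "prob_space (uniform_sphere \<eta>)"
  unfolding uniform_sphere_def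
  by (intro prob_space.prob_space_distr prob_space_uniform_unit_cball) simp

text \<open>An inequality suffices for the estimates, and it holds at every point of the ball,
  including the origin, which \<open>sgn\<close> sends to 0.\<close>

lemma AE_uniform_sphere_norm_le:
  fixes \<eta> :: real
  assumes "0 < \<eta>"
  shows "AE v in uniform_sphere \<eta>. norm (v::'a::euclidean_space) \<le> \<eta>"
  unfolding uniform_sphere_def using assms
  by (subst AE_distr_iff) (auto simp: norm_sgn)

lemma integral_uniform_sphere:
  fixes g :: "'a::euclidean_space \<Rightarrow> real"
  assumes [measurable]: "g \<in> borel_measurable borel"
  shows "(\<integral>v. g v \<partial>uniform_sphere \<eta>)
       = (\<integral>u. indicator (cball 0 1) u * g (\<eta> *\<^sub>R sgn u) \<partial>lborel) / measure lborel (cball (0::'a) 1)"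
proof -
  have "(\<integral>v. g v \<partial>uniform_sphere \<eta>) = (\<integral>u. g (\<eta> *\<^sub>R sgn u) \<partial>uniform_measure lborel (cball (0::'a) 1))"
    unfolding uniform_sphere_def by (rule integral_distr) auto
  also have "\<dots> = (\<integral>u. indicator (cball 0 1) u / measure lborel (cball (0::'a) 1) * g (\<eta> *\<^sub>R sgn u) \<partial>lborel)"
    unfolding uniform_unit_cball_density by (subst integral_density) auto
  finally show ?thesis by simp
qed

text \<open>The difference with \<open>H x\<close> keeps the integrand below the dimension times the
  Lipschitz constant, and makes it the one-sample estimator averaged over the replicate. No
  cancellation over the sphere has to be shown: \<open>smoothed_expansion\<close> works with
  \<open>H (x + \<eta> *\<^sub>R z) - H x\<close> from the start, and increments do not see the
  constant.\<close>

definition spherical_gradient :: "real \<Rightarrow> ('a::euclidean_space \<Rightarrow> real) \<Rightarrow> 'a \<Rightarrow> 'a" where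
  "spherical_gradient \<eta> H x =
     (\<integral>v. (real DIM('a) * (H (x + v) - H x) / (norm v * \<eta>)) *\<^sub>R v \<partial>uniform_sphere \<eta>)"

lemma norm_finite_difference_le:
  fixes H :: "'a::euclidean_space \<Rightarrow> real" and L :: real
  assumes H: "L-lipschitz_on UNIV H" and \<eta>: "0 < \<eta>" and v: "norm v \<le> \<eta>"
  shows "norm ((real DIM('a) * (H (x + v) - H x) / (norm v * \<eta>)) *\<^sub>R v) \<le> real DIM('a) * L"
proof (cases "v = 0")
  case False
  have L: "0 \<le> L" using H by (rule lipschitz_on_nonneg)
  have "norm ((real DIM('a) * (H (x + v) - H x) / (norm v * \<eta>)) *\<^sub>R v)
      = real DIM('a) * \<bar>H (x + v) - H x\<bar> / \<eta>"
    using False \<eta> by (simp add: abs_mult)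
  also have "\<dots> \<le> real DIM('a) * (L * \<eta>) / \<eta>"
    using order_trans [OF lipschitz_UNIV_bound [OF H] mult_left_mono [OF v L]] \<eta>
    by (intro divide_right_mono mult_left_mono) auto
  finally show ?thesis using \<eta> by simp
qed (use lipschitz_on_nonneg [OF H] in simp)

lemma spherical_gradient_inner:
  fixes H :: "'a::euclidean_space \<Rightarrow> real" and L \<eta> :: real
  assumes H: "L-lipschitz_on UNIV H" and \<eta>: "0 < \<eta>"
  shows "spherical_gradient \<eta> H x \<bullet> h * measure lborel (cball (0::'a) 1)
    = DIM('a) * (\<integral>u. indicator (cball 0 1) u * ((H (x + \<eta> *\<^sub>R sgn u) - H x) * (sgn u \<bullet> (h /\<^sub>R \<eta>))) \<partial>lborel)"
proof -
  note [measurable] = borel_measurable_lipschitz_UNIV [OF H]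
  let ?f = "\<lambda>v. (real DIM('a) * (H (x + v) - H x) / (norm v * \<eta>)) *\<^sub>R v"
  have int: "integrable (uniform_sphere \<eta>) ?f"
  proof -
    interpret prob_space "uniform_sphere \<eta> :: 'a measure" by (rule prob_space_uniform_sphere)
    show ?thesis
      using norm_finite_difference_le [OF H \<eta>] AE_uniform_sphere_norm_le [OF \<eta>, where 'a = 'a]
      by (intro integrable_const_bound [where B = "real DIM('a) * L"]) auto
  qed
  have "spherical_gradient \<eta> H x \<bullet> h = (\<integral>v. ?f v \<bullet> h \<partial>uniform_sphere \<eta>)"
    unfolding spherical_gradient_def by (rule integral_inner_left [symmetric]) (rule int)
  also have "\<dots> = (\<integral>u. indicator (cball 0 1) u * (?f (\<eta> *\<^sub>R sgn u) \<bullet> h) \<partial>lborel) / measure lborel (cball (0::'a) 1)"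
    by (rule integral_uniform_sphere) measurable
  also have "(\<integral>u. indicator (cball 0 1) u * (?f (\<eta> *\<^sub>R sgn u) \<bullet> h) \<partial>lborel)
      = (\<integral>u. DIM('a) * (indicator (cball 0 1) u * ((H (x + \<eta> *\<^sub>R sgn u) - H x) * (sgn u \<bullet> (h /\<^sub>R \<eta>)))) \<partial>lborel)"
  proof (intro Bochner_Integration.integral_cong refl)
    fix u :: 'a
    show "indicator (cball 0 1) u * (?f (\<eta> *\<^sub>R sgn u) \<bullet> h)
        = DIM('a) * (indicator (cball 0 1) u * ((H (x + \<eta> *\<^sub>R sgn u) - H x) * (sgn u \<bullet> (h /\<^sub>R \<eta>))))"
      using \<eta> by (cases "u = 0") (simp_all add: norm_sgn field_simps)
  qed
  finally show ?thesis by simp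
qed

text \<open>In the variable \<open>z\<close> the Lipschitz constant becomes
  \<open>L * \<eta>\<close> and the displacement \<open>h /\<^sub>R \<eta>\<close>, so the quadratic
  error scales to \<open>DIM('a) * L / (2 * \<eta>)\<close>. Both directions matter: together they
  give the derivative, and the upper one is the descent inequality.\<close>

lemma smoothed_expansion:
  fixes H :: "'a::euclidean_space \<Rightarrow> real" and L \<eta> :: real
  assumes H: "L-lipschitz_on UNIV H" and \<eta>: "0 < \<eta>"
  shows "\<bar>smoothed \<eta> H (x + h) - smoothed \<eta> H x - spherical_gradient \<eta> H x \<bullet> h\<bar>
       \<le> DIM('a) * L / (2 * \<eta>) * (norm h)\<^sup>2"
proof -
  note [measurable] = borel_measurable_lipschitz_UNIV [OF H]
  have L: "0 \<le> L" using H by (rule lipschitz_on_nonneg)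
  let ?V = "measure lborel (cball (0::'a) 1)"
  let ?H = "\<lambda>z. H (x + \<eta> *\<^sub>R z) - H x"
  have lip: "(L * \<eta>)-lipschitz_on UNIV ?H"
  proof (rule lipschitz_onI)
    fix y z
    have "dist (?H y) (?H z) = dist (H (x + \<eta> *\<^sub>R y)) (H (x + \<eta> *\<^sub>R z))" by (simp add: dist_real_def)
    also have "\<dots> \<le> L * dist (x + \<eta> *\<^sub>R y) (x + \<eta> *\<^sub>R z)" by (rule lipschitz_onD [OF H]) auto
    also have "\<dots> = L * \<eta> * dist y z"
      using \<eta> by (simp add: dist_norm scaleR_diff_right [symmetric])
    finally show "dist (?H y) (?H z) \<le> L * \<eta> * dist y z" .
  qed (use L \<eta> in simp)
  have int: "integrable lborel (\<lambda>u. indicator (cball 0 1) u * H (a + \<eta> *\<^sub>R u))" for a :: 'a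
  proof (rule integrable_lborel_bounded_support [where r = 1 and B = "\<bar>H 0\<bar> + L * (norm a + \<eta>)"])
    show "norm (indicator (cball 0 1) u * H (a + \<eta> *\<^sub>R u)) \<le> \<bar>H 0\<bar> + L * (norm a + \<eta>)" if "norm u \<le> 1" for u
    proof -
      have "norm (a + \<eta> *\<^sub>R u) \<le> norm a + \<eta>"
        using norm_triangle_ineq [of a "\<eta> *\<^sub>R u"] norm_scaled_le [OF \<eta> that] by linarith
      then show ?thesis using lipschitz_UNIV_growth [OF H] that by simp
    qed
  qed auto
  have "(\<integral>u. indicator (cball 0 1) u * (?H (u + h /\<^sub>R \<eta>) - ?H u) \<partial>lborel)
      = (\<integral>u. indicator (cball 0 1) u * H (x + h + \<eta> *\<^sub>R u) - indicator (cball 0 1) u * H (x + \<eta> *\<^sub>R u) \<partial>lborel)"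
    using \<eta> by (intro Bochner_Integration.integral_cong) (auto simp: algebra_simps)
  also have "\<dots> = (\<integral>u. indicator (cball 0 1) u * H (x + h + \<eta> *\<^sub>R u) \<partial>lborel) - (\<integral>u. indicator (cball 0 1) u * H (x + \<eta> *\<^sub>R u) \<partial>lborel)"
    by (rule Bochner_Integration.integral_diff [OF int int])
  also have "\<dots> = ?V * (smoothed \<eta> H (x + h) - smoothed \<eta> H x)"
    using measure_unit_cball_pos [where 'a = 'a]
    by (simp add: smoothed_def set_lebesgue_integral_def right_diff_distrib del: content_cball_gt_0_iff)
  finally have D: "(\<integral>u. indicator (cball 0 1) u * (?H (u + h /\<^sub>R \<eta>) - ?H u) \<partial>lborel)
      = ?V * (smoothed \<eta> H (x + h) - smoothed \<eta> H x)" .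
  have "\<bar>?V * (smoothed \<eta> H (x + h) - smoothed \<eta> H x) - spherical_gradient \<eta> H x \<bullet> h * ?V\<bar>
      \<le> DIM('a) * (L * \<eta>) / 2 * (norm (h /\<^sub>R \<eta>))\<^sup>2 * ?V"
    using unit_ball_smoothing_expansion [OF lip, of "h /\<^sub>R \<eta>"]
    unfolding D spherical_gradient_inner [OF H \<eta>] .
  also have "\<dots> = DIM('a) * L / (2 * \<eta>) * (norm h)\<^sup>2 * ?V"
    using \<eta> by (simp add: power_mult_distrib power_divide field_simps power2_eq_square)
  finally have "\<bar>smoothed \<eta> H (x + h) - smoothed \<eta> H x - spherical_gradient \<eta> H x \<bullet> h\<bar> * ?V
      \<le> DIM('a) * L / (2 * \<eta>) * (norm h)\<^sup>2 * ?V"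
    by (metis (no_types, lifting) abs_mult abs_of_nonneg left_diff_distrib mult.commute measure_nonneg)
  then show ?thesis
    using measure_unit_cball_pos [where 'a = 'a] mult_le_cancel_right_pos by blast
qed

text \<open>Used at both ends of the output window to return from the smoothed function to
  \<open>H\<close>; this is the term \<open>2 * L0 * \<eta>\<close> of the final bound.\<close>

lemma smoothed_close:
  fixes H :: "'a::euclidean_space \<Rightarrow> real" and L \<eta> :: real
  assumes H: "L-lipschitz_on UNIV H" and \<eta>: "0 < \<eta>"
  shows "\<bar>smoothed \<eta> H x - H x\<bar> \<le> L * \<eta>"
proof -
  note [measurable] = borel_measurable_lipschitz_UNIV [OF H]
  have L: "0 \<le> L" using H by (rule lipschitz_on_nonneg)
  let ?V = "measure lborel (cball (0::'a) 1)"
  have bd: "\<bar>H (x + \<eta> *\<^sub>R u) - H x\<bar> \<le> L * \<eta>" if "norm u \<le> 1" for u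
    using order_trans [OF lipschitz_UNIV_bound [OF H] mult_left_mono [OF _ L], of "\<eta> *\<^sub>R u" \<eta> x]
      norm_scaled_le [OF \<eta> that] by simp
  have ic: "integrable lborel (\<lambda>u::'a. indicator (cball 0 1) u * c)" for c :: real
    by (intro integrable_lborel_bounded_support [where r = 1 and B = "\<bar>c\<bar>"]) (auto simp: indicator_def)
  have id: "integrable lborel (\<lambda>u. indicator (cball 0 1) u * (H (x + \<eta> *\<^sub>R u) - H x))"
    using bd \<eta> L
    by (intro integrable_lborel_bounded_support [where r = 1 and B = "L * \<eta>"]) (auto simp: indicator_def)
  have "?V * smoothed \<eta> H x = (\<integral>u. indicator (cball 0 1) u * (H (x + \<eta> *\<^sub>R u) - H x) + indicator (cball 0 1) u * H x \<partial>lborel)"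
    using measure_unit_cball_pos [where 'a = 'a]
    by (simp add: smoothed_def set_lebesgue_integral_def algebra_simps del: content_cball_gt_0_iff)
  also have "\<dots> = (\<integral>u. indicator (cball 0 1) u * (H (x + \<eta> *\<^sub>R u) - H x) \<partial>lborel) + ?V * H x"
    by (subst Bochner_Integration.integral_add [OF id ic]) simp
  finally have eq: "(smoothed \<eta> H x - H x) * ?V = (\<integral>u. indicator (cball 0 1) u * (H (x + \<eta> *\<^sub>R u) - H x) \<partial>lborel)"
    by (simp add: algebra_simps)
  have "\<bar>(smoothed \<eta> H x - H x) * ?V\<bar> \<le> (\<integral>u. indicator (cball 0 1) (u::'a) * (L * \<eta>) \<partial>lborel)"
    unfolding eq by (rule integral_abs_bound_integral [OF id ic]) (use bd in \<open>auto simp: indicator_def\<close>)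
  then have "\<bar>smoothed \<eta> H x - H x\<bar> * ?V \<le> L * \<eta> * ?V"
    by (simp add: abs_mult ac_simps)
  then show ?thesis
    using measure_unit_cball_pos [where 'a = 'a] mult_le_cancel_right_pos by blast
qed

lemma gradient_eqI:
  assumes "GDERIV f x :> D"
  shows "gradient f x = D"
  unfolding gradient_def
proof (rule the_equality)
  show "GDERIV f x :> D" by (rule assms)
  fix D' assume "GDERIV f x :> D'"
  then have "(\<lambda>h. h \<bullet> D') = (\<lambda>h. h \<bullet> D)"
    using assms unfolding gderiv_def by (rule has_derivative_unique)
  then show "D' = D" by (metis inner_commute vector_eq_rdot)
qed

text \<open>A derivative at \<open>x\<close> needs a whole neighbourhood. For \<open>y\<close>
  within \<open>\<eta>0 - \<eta>\<close> of \<open>x\<close> the averaging ball around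
  \<open>y\<close> stays in \<open>cball x \<eta>0\<close>, where the two functions agree; the
  strict inequality makes this neighbourhood nonempty.\<close>

lemma gradient_smoothed:
  fixes H F :: "'a::euclidean_space \<Rightarrow> real" and L \<eta> \<eta>0 :: real
  assumes H: "L-lipschitz_on UNIV H" and \<eta>: "0 < \<eta>" "\<eta> < \<eta>0"
    and eq: "\<And>z. z \<in> cball x \<eta>0 \<Longrightarrow> F z = H z"
  shows "gradient (smoothed \<eta> F) x = spherical_gradient \<eta> H x"
proof (rule gradient_eqI, unfold gderiv_def)
  let ?g = "spherical_gradient \<eta> H x"
  let ?c = "DIM('a) * L / (2 * \<eta>)"
  have "(smoothed \<eta> H has_derivative (\<lambda>h. h \<bullet> ?g)) (at x)"
  proof (rule has_derivativeI_sandwich [of 1])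
    fix y assume "y \<noteq> x"
    have "\<bar>smoothed \<eta> H y - smoothed \<eta> H x - (y - x) \<bullet> ?g\<bar> \<le> ?c * (norm (y - x))\<^sup>2"
      using smoothed_expansion [OF H \<eta>(1), of x "y - x"] by (simp add: inner_commute)
    then show "norm (smoothed \<eta> H y - smoothed \<eta> H x - (y - x) \<bullet> ?g) / norm (y - x) \<le> ?c * norm (y - x)"
      using \<open>y \<noteq> x\<close> by (simp add: divide_le_eq power2_eq_square mult.assoc)
  next
    have "((\<lambda>y. ?c * norm (y - x)) \<longlongrightarrow> ?c * norm (x - x)) (at x)"
      by (intro tendsto_intros)
    then show "((\<lambda>y. ?c * norm (y - x)) \<longlongrightarrow> 0) (at x)" by simp
  qed (auto intro: bounded_linear_inner_left)
  then show "(smoothed \<eta> F has_derivative (\<lambda>h. h \<bullet> ?g)) (at x)"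
  proof (rule has_derivative_transform_within_open [where s = "ball x (\<eta>0 - \<eta>)"])
    fix y assume y: "y \<in> ball x (\<eta>0 - \<eta>)"
    have "y + \<eta> *\<^sub>R u \<in> cball x \<eta>0" if "norm u \<le> 1" for u
    proof -
      have "dist x (y + \<eta> *\<^sub>R u) \<le> dist x y + norm (\<eta> *\<^sub>R u)"
        by (metis dist_triangle_le dist_add_cancel dist_0_norm add.right_neutral dist_triangle)
      then show ?thesis using y norm_scaled_le [OF \<eta>(1) that] unfolding mem_ball mem_cball by linarith
    qed
    then show "smoothed \<eta> H y = smoothed \<eta> F y"
      unfolding smoothed_def set_lebesgue_integral_def
      by (intro arg_cong2 [where f = "(/)"] Bochner_Integration.integral_cong refl)
         (auto simp: indicator_def eq)
  qed (use \<eta> in auto)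
qed

section \<open>Projected gradient steps, output window and independence\<close>

text \<open>Composing with simple functions \<open>s i\<close> that converge to the identity leaves
  finite case distinctions over measurable sections, and continuity in \<open>z\<close> identifies
  the limit. The problem gives measurability only at each fixed point, whereas the product laws
  below call for joint measurability.\<close>

lemma borel_measurable_Caratheodory:
  fixes \<phi> :: "'a::euclidean_space \<Rightarrow> 'w \<Rightarrow> real"
  assumes meas [measurable]: "\<And>z. \<phi> z \<in> borel_measurable M"
    and cont: "\<And>\<omega>. \<omega> \<in> space M \<Longrightarrow> continuous_on UNIV (\<lambda>z. \<phi> z \<omega>)"
  shows "(\<lambda>(z, \<omega>). \<phi> z \<omega>) \<in> borel_measurable (borel \<Otimes>\<^sub>M M)"
proof -
  obtain s :: "nat \<Rightarrow> 'a \<Rightarrow> 'a" where s: "\<And>i. simple_function borel (s i)"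
      "\<And>z. (\<lambda>i. s i z) \<longlonglongrightarrow> z"
    using borel_measurable_implies_sequence_metric [of "\<lambda>z::'a. z" borel 0] by auto
  show ?thesis
  proof (rule borel_measurable_LIMSEQ_real)
    fix p assume p: "p \<in> space (borel \<Otimes>\<^sub>M M :: ('a \<times> 'w) measure)"
    obtain z \<omega> where z: "p = (z, \<omega>)" by (cases p)
    have "isCont (\<lambda>z. \<phi> z \<omega>) z"
      using cont [of \<omega>] p by (auto simp: z space_pair_measure continuous_on_eq_continuous_at)
    then show "(\<lambda>i. case p of (z, \<omega>) \<Rightarrow> \<phi> (s i z) \<omega>) \<longlonglongrightarrow> (case p of (z, \<omega>) \<Rightarrow> \<phi> z \<omega>)"
      using s(2) by (auto simp: z intro: isCont_tendsto_compose)
  next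
    fix i
    have fin: "finite (range (s i))" using s(1) [of i] by (auto simp: simple_function_def)
    have "s i \<in> measurable borel (count_space (range (s i)))"
      using s(1) [of i] fin by (auto simp: measurable_count_space_eq2 simple_function_def)
    then have si: "(\<lambda>p. s i (fst p)) \<in> measurable (borel \<Otimes>\<^sub>M M) (count_space (range (s i)))"
      by (rule measurable_compose [OF measurable_fst])
    have "(\<lambda>p. \<phi> (s i (fst p)) (snd p)) \<in> borel_measurable (borel \<Otimes>\<^sub>M M)"
      by (rule measurable_compose_countable' [where f = "\<lambda>c p. \<phi> c (snd p)", OF _ si countable_finite [OF fin]])
        measurable
    then show "(\<lambda>p. case p of (z, \<omega>) \<Rightarrow> \<phi> (s i z) \<omega>) \<in> borel_measurable (borel \<Otimes>\<^sub>M M)"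
      by (simp add: case_prod_beta')
  qed
qed

text \<open>\<open>gb\<close> is the sampled gradient and \<open>g\<close> the exact one. The
  projection inequality and Young's inequality bound \<open>(1 - L * \<gamma>) / 2\<close> times the
  squared step by the decrease of \<open>S\<close>, scaled by \<gamma>, plus half of the squared
  error \<open>\<gamma>\<^sup>2 * E\<close>; the squared residual is at most twice the sum of these
  two squares. Hence the 1/4 on the left, and on the right 1/2 + (1 - L \<gamma>) / 2 = 1 - L
  \<gamma> / 2.\<close>

lemma projected_gradient_step:
  fixes x g gb :: "'a::euclidean_space" and S :: "'a \<Rightarrow> real" and L \<gamma> :: real
  assumes X: "convex X" "closed X" "x \<in> X" and \<gamma>: "0 < \<gamma>" and L\<gamma>: "L * \<gamma> \<le> 1"
    and y: "y = closest_point X (x - \<gamma> *\<^sub>R gb)"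
    and descent: "S y \<le> S x + g \<bullet> (y - x) + L / 2 * (norm (y - x))\<^sup>2"
  shows "(1 - L * \<gamma>) * (\<gamma> / 4) * (norm ((1 / \<gamma>) *\<^sub>R (x - closest_point X (x - \<gamma> *\<^sub>R g))))\<^sup>2
       \<le> S x - S y + \<gamma> * (1 - L * \<gamma> / 2) * (norm (gb - g))\<^sup>2"
proof -
  define d e D E where "d = y - x" and "e = g - gb" and "D = (norm d)\<^sup>2" and "E = (norm e)\<^sup>2"
  let ?r = "x - closest_point X (x - \<gamma> *\<^sub>R g)"
  \<comment> \<open>Variational inequality of the projection, tested at \<open>x\<close>, which lies
    in \<open>X\<close>.\<close>
  have "((x - \<gamma> *\<^sub>R gb) - y) \<bullet> (x - y) \<le> 0"
    unfolding y by (rule closest_point_dot [OF X])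
  then have proj: "D + \<gamma> * (gb \<bullet> d) \<le> 0"
    unfolding D_def d_def power2_norm_eq_inner
    by (simp add: inner_diff_left inner_diff_right inner_commute algebra_simps)
  have "(norm (\<gamma> *\<^sub>R e - d))\<^sup>2 = \<gamma>\<^sup>2 * E - 2 * \<gamma> * (e \<bullet> d) + D"
    unfolding D_def E_def power2_norm_eq_inner
    by (simp add: inner_diff_left inner_diff_right inner_commute power2_eq_square algebra_simps)
  then have young: "2 * \<gamma> * (e \<bullet> d) \<le> \<gamma>\<^sup>2 * E + D"
    using zero_le_power2 [of "norm (\<gamma> *\<^sub>R e - d)"] by linarith
  \<comment> \<open>The residual uses the exact gradient, the step the sampled one; nonexpansiveness
    of the projection bounds the discrepancy by \<open>\<gamma> * norm e\<close>.\<close>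
  have "norm ?r \<le> norm d + norm (y - closest_point X (x - \<gamma> *\<^sub>R g))"
    using norm_triangle_ineq [of "x - y" "y - closest_point X (x - \<gamma> *\<^sub>R g)"]
    by (simp add: d_def norm_minus_commute)
  also have "norm (y - closest_point X (x - \<gamma> *\<^sub>R g)) \<le> \<gamma> * norm e"
    using closest_point_lipschitz [OF X(1,2), of "x - \<gamma> *\<^sub>R gb" "x - \<gamma> *\<^sub>R g"] X(3) \<gamma>
    by (auto simp: y dist_norm e_def scaleR_diff_right [symmetric])
  finally have "(norm ?r)\<^sup>2 \<le> (norm d + \<gamma> * norm e)\<^sup>2" by (intro power_mono) auto
  also have "\<dots> \<le> 2 * D + 2 * \<gamma>\<^sup>2 * E"
    using sum_squares_bound [of "norm d" "\<gamma> * norm e"]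
    by (simp add: power2_sum D_def E_def power_mult_distrib)
  finally have "(norm ?r)\<^sup>2 \<le> 2 * D + 2 * \<gamma>\<^sup>2 * E" .
  then have 1: "(1 - L * \<gamma>) * (norm ?r)\<^sup>2 \<le> (1 - L * \<gamma>) * (2 * D + 2 * \<gamma>\<^sup>2 * E)"
    using L\<gamma> by (intro mult_left_mono) auto
  have "\<gamma> * S y \<le> \<gamma> * (S x + g \<bullet> d + L / 2 * D)"
    using descent \<gamma> by (intro mult_left_mono) (auto simp: d_def D_def)
  also have "\<dots> = \<gamma> * S x + \<gamma> * (gb \<bullet> d) + \<gamma> * (e \<bullet> d) + L * \<gamma> * D / 2"
    by (simp add: e_def inner_diff_left algebra_simps)
  finally have 2: "\<gamma> * S y \<le> \<gamma> * S x + \<gamma> * (gb \<bullet> d) + \<gamma> * (e \<bullet> d) + L * \<gamma> * D / 2" .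
  have "(1 - L * \<gamma>) / 4 * (norm ?r)\<^sup>2 \<le> D / 2 - L * \<gamma> * D / 2 + \<gamma>\<^sup>2 * E / 2 - L * \<gamma> * (\<gamma>\<^sup>2 * E) / 2"
  proof -
    have "(1 - a) / 4 * r \<le> D / 2 - a * D / 2 + P / 2 - a * P / 2"
      if "(1 - a) * r \<le> (1 - a) * (2 * D + 2 * P)" for a r P :: real
      using divide_right_mono [OF that, of 4] by (simp add: field_simps)
    from this [of "L * \<gamma>" "(norm ?r)\<^sup>2" "\<gamma>\<^sup>2 * E"] 1 show ?thesis by (simp only: mult.assoc)
  qed
  also have "\<dots> \<le> \<gamma> * S x - \<gamma> * S y + \<gamma>\<^sup>2 * E - L * \<gamma> * (\<gamma>\<^sup>2 * E) / 2"
    using 2 proj young by linarith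
  also have "\<dots> = \<gamma> * (S x - S y) + \<gamma>\<^sup>2 * (1 - L * \<gamma> / 2) * E"
    by (simp add: algebra_simps)
  finally have 3: "(1 - L * \<gamma>) / 4 * (norm ?r)\<^sup>2 \<le> \<gamma> * (S x - S y) + \<gamma>\<^sup>2 * (1 - L * \<gamma> / 2) * E" .
  have e1: "(1 - L * \<gamma>) * (\<gamma> / 4) * (norm ((1 / \<gamma>) *\<^sub>R ?r))\<^sup>2 = (1 - L * \<gamma>) / 4 * (norm ?r)\<^sup>2 / \<gamma>"
    using \<gamma> by (simp add: power_divide power2_eq_square)
  have e2: "S x - S y + \<gamma> * (1 - L * \<gamma> / 2) * E = (\<gamma> * (S x - S y) + \<gamma>\<^sup>2 * (1 - L * \<gamma> / 2) * E) / \<gamma>"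
    using \<gamma> by (simp add: add_divide_distrib power2_eq_square)
  have n: "(norm (gb - g))\<^sup>2 = E" by (simp add: E_def e_def norm_minus_commute)
  show ?thesis unfolding n e1 e2 by (rule divide_right_mono [OF 3 less_imp_le [OF \<gamma>]])
qed

section \<open>The output window and its harmonic sum\<close>

lemma start_index_bounds:
  assumes "0 < lam" "lam < 1" "1 \<le> K"
  shows "1 \<le> start_index lam K" "start_index lam K \<le> K"
    "lam * real K \<le> real (start_index lam K)" "real (start_index lam K) < lam * real K + 1"
proof -
  have pos: "0 < lam * real K" using assms by simp
  then have nn: "0 \<le> \<lceil>lam * real K\<rceil>" by linarith
  then have eq: "real (start_index lam K) = of_int \<lceil>lam * real K\<rceil>"
    by (simp add: start_index_def)
  show a: "lam * real K \<le> real (start_index lam K)" "real (start_index lam K) < lam * real K + 1"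
    unfolding eq by linarith+
  show "1 \<le> start_index lam K" using a pos by linarith
  have "lam * real K \<le> real K" using assms by (intro mult_left_le_one_le) auto
  then have "\<lceil>lam * real K\<rceil> \<le> int K" by (simp add: ceiling_le_iff)
  then show "start_index lam K \<le> K" unfolding start_index_def by (simp only: nat_le_iff)
qed

lemma sum_reciprocal_le_ln:
  assumes "l \<le> K"
  shows "(\<Sum>k = l..K. 1 / (real k + 1)) \<le> 1 / (real l + 1) + ln (real K + 1) - ln (real l + 1)"
  using assms
proof (induction K rule: dec_induct)
  case (step K)
  \<comment> \<open>\<open>ln t \<le> t - 1\<close> at \<open>t = (K + 1) / (K + 2)\<close> compares
    the new term with the increment of the logarithm.\<close>
  have "ln ((real K + 1) / (real K + 2)) \<le> (real K + 1) / (real K + 2) - 1"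
    by (intro ln_le_minus_one) auto
  then have "1 / (real K + 2) \<le> ln (real K + 2) - ln (real K + 1)"
    by (simp add: ln_div field_simps)
  then show ?case using step by (simp add: add.commute)
qed simp

text \<open>The window starts at index 1 or later, so its first term is at most 1/2; the others add
  up to at most the logarithm of \<open>(K + 1) / (l + 1)\<close>, a quotient of at most
  \<open>1 / lam\<close>.\<close>

lemma sum_reciprocal_window:
  assumes "0 < lam" "lam < 1" "1 \<le> K"
  shows "(\<Sum>k = start_index lam K..K. 1 / (real k + 1)) \<le> 1 / 2 - ln lam"
proof -
  let ?l = "start_index lam K"
  note b = start_index_bounds [OF assms]
  have "lam * (real K + 1) \<le> real ?l + 1"
    using b(3) assms by (simp add: algebra_simps)
  then have "ln (lam * (real K + 1)) \<le> ln (real ?l + 1)"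
    using assms by (subst ln_le_cancel_iff) auto
  then have "ln lam + ln (real K + 1) \<le> ln (real ?l + 1)"
    using assms by (simp add: ln_mult)
  moreover have "1 / (real ?l + 1) \<le> 1 / 2"
    using b(1) by (simp add: field_simps)
  ultimately show ?thesis using sum_reciprocal_le_ln [OF b(2)] by linarith
qed

section \<open>Independence via sub-sigma-algebras\<close>

lemma (in prob_space) indep_var_subalgebras:
  assumes indep: "indep_set (sets N1) (sets N2)" and sp: "space N1 = space M" "space N2 = space M"
    and X: "X \<in> measurable N1 S" and Y: "Y \<in> measurable N2 T"
  shows "indep_var S X T Y"
proof -
  have sub: "sets N1 \<subseteq> events" "sets N2 \<subseteq> events"
    using indep_setD_ev1 [OF indep] indep_setD_ev2 [OF indep] by auto
  have rv: "random_variable S X" "random_variable T Y"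
    using X Y sub sp by (auto simp: measurable_def)
  have 1: "sigma_sets (space M) {X -` A \<inter> space M | A. A \<in> sets S} \<subseteq> sets N1"
    using measurable_sets [OF X] unfolding sp(1) [symmetric] by (intro sets.sigma_sets_subset) auto
  have 2: "sigma_sets (space M) {Y -` A \<inter> space M | A. A \<in> sets T} \<subseteq> sets N2"
    using measurable_sets [OF Y] unfolding sp(2) [symmetric] by (intro sets.sigma_sets_subset) auto
  show ?thesis
    unfolding indep_var_eq indep_set_def
  proof (intro conjI rv indep_sets_mono_sets [OF indep [unfolded indep_set_def]])
    show "case_bool (sigma_sets (space M) {X -` A \<inter> space M | A. A \<in> sets S})
        (sigma_sets (space M) {Y -` A \<inter> space M | A. A \<in> sets T}) b
        \<subseteq> case_bool (sets N1) (sets N2) b" for b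
      using 1 2 by (cases b) simp_all
  qed
qed

text \<open>The library's \<open>indep_var\<close> forces both variables to have the same type.\<close>

lemma (in prob_space) distr_pair_subalgebras:
  assumes indep: "indep_set (sets N1) (sets N2)" and sp: "space N1 = space M" "space N2 = space M"
    and X: "X \<in> measurable N1 S" and Y: "Y \<in> measurable N2 T"
  shows "distr M (S \<Otimes>\<^sub>M T) (\<lambda>q. (X q, Y q)) = distr M S X \<Otimes>\<^sub>M distr M T Y"
proof -
  have sub: "sets N1 \<subseteq> events" "sets N2 \<subseteq> events"
    using indep_setD_ev1 [OF indep] indep_setD_ev2 [OF indep] by auto
  have [measurable]: "random_variable S X" "random_variable T Y"
    using X Y sub sp by (auto simp: measurable_def)
  interpret X: prob_space "distr M S X" by (rule prob_space_distr) simp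
  interpret Y: prob_space "distr M T Y" by (rule prob_space_distr) simp
  show ?thesis
  proof (rule pair_measure_eqI [symmetric])
    fix A B assume "A \<in> sets (distr M S X)" "B \<in> sets (distr M T Y)"
    then have [measurable]: "A \<in> sets S" "B \<in> sets T" by auto
    have "emeasure (distr M (S \<Otimes>\<^sub>M T) (\<lambda>q. (X q, Y q))) (A \<times> B)
        = emeasure M ((X -` A \<inter> space M) \<inter> (Y -` B \<inter> space M))"
      by (subst emeasure_distr) (auto intro!: arg_cong [where f = "emeasure M"])
    also have "\<dots> = emeasure M (X -` A \<inter> space M) * emeasure M (Y -` B \<inter> space M)"
      using indep_setD [OF indep, of "X -` A \<inter> space M" "Y -` B \<inter> space M"]
        measurable_sets [OF X, of A] measurable_sets [OF Y, of B]
      by (simp add: sp emeasure_eq_measure ennreal_mult)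
    finally show "emeasure (distr M S X) A * emeasure (distr M T Y) B
        = emeasure (distr M (S \<Otimes>\<^sub>M T) (\<lambda>q. (X q, Y q))) (A \<times> B)"
      by (simp add: emeasure_distr)
  qed (auto intro: X.sigma_finite_measure_axioms Y.sigma_finite_measure_axioms)
qed

text \<open>The output is split over the value of \<open>R\<close>. The event that \<open>R\<close>
  equals \<open>k\<close> is independent of everything \<open>N\<close>-measurable, so each term
  factors, and all \<open>Suc K - l\<close> values are equally likely.\<close>

lemma (in prob_space) expectation_uniform_index:
  fixes h :: "nat \<Rightarrow> 'a \<Rightarrow> real"
  assumes R [measurable]: "R \<in> measurable M (count_space UNIV)"
    and R_distr: "distr M (count_space UNIV) R = measure_pmf (pmf_of_set {l..K})" and "l \<le> K"
    and indep: "indep_set (sets (vimage_algebra (space M) R (count_space UNIV))) (sets N)"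
    and N: "space N = space M" "\<And>k. h k \<in> borel_measurable N"
    and int: "\<And>k. k \<in> {l..K} \<Longrightarrow> integrable M (h k)"
  shows "expectation (\<lambda>q. h (R q) q) = (\<Sum>k = l..K. expectation (h k)) / real (Suc K - l)"
proof -
  have ne: "{l..K} \<noteq> {}" using \<open>l \<le> K\<close> by simp
  have prob: "prob (R -` A \<inter> space M) = measure_pmf.prob (pmf_of_set {l..K}) A" for A
    unfolding R_distr [symmetric] by (rule measure_distr [symmetric]) auto
  have "prob (R -` {l..K} \<inter> space M) = 1"
    unfolding prob using ne by (simp add: measure_pmf_of_set)
  then have AE: "AE q in M. R q \<in> {l..K}"
    using prob_Collect_eq_1 [of "\<lambda>q. R q \<in> {l..K}"] by (auto simp: vimage_def Int_def conj_commute)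
  have hm [measurable]: "h k \<in> borel_measurable M" for k
    using N(2) [of k] indep_setD_ev2 [OF indep] N(1) by (auto simp: measurable_def)
  have ind: "indep_var borel (\<lambda>q. indicator {k} (R q) :: real) borel (h k)" for k
  proof (rule indep_var_subalgebras [OF indep _ N(1) _ N(2)])
    show "(\<lambda>q. indicator {k} (R q) :: real) \<in> borel_measurable (vimage_algebra (space M) R (count_space UNIV))"
      by (rule measurable_compose [OF measurable_vimage_algebra1]) auto
  qed simp
  have ik: "integrable M (\<lambda>q. indicator {k} (R q) :: real)" for k
    by (rule integrable_const_bound [where B = 1]) (auto intro!: measurable_compose [OF R])
  \<comment> \<open>Only the law of \<open>R\<close> is known, so \<open>R\<close> lies in the
    window almost surely and the two integrands agree almost everywhere.\<close>
  have "expectation (\<lambda>q. h (R q) q) = expectation (\<lambda>q. \<Sum>k = l..K. indicator {k} (R q) * h k q)"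
  proof (rule integral_cong_AE)
    show "(\<lambda>q. \<Sum>k = l..K. indicator {k} (R q) * h k q) \<in> borel_measurable M"
      by (intro borel_measurable_sum borel_measurable_times hm borel_measurable_integrable [OF ik])
    show "AE q in M. h (R q) q = (\<Sum>k = l..K. indicator {k} (R q) * h k q)"
      using AE by eventually_elim (simp add: indicator_def if_distrib [of "\<lambda>x. x * _"] sum.delta' cong: if_cong)
    show "(\<lambda>q. h (R q) q) \<in> borel_measurable M"
      by (rule measurable_compose_countable [OF hm R])
  qed
  also have "\<dots> = (\<Sum>k = l..K. expectation (\<lambda>q. indicator {k} (R q) * h k q))"
    by (intro Bochner_Integration.integral_sum indep_var_integrable ik int ind) auto
  also have "\<dots> = (\<Sum>k = l..K. expectation (h k) / real (Suc K - l))"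
  proof (intro sum.cong refl)
    fix k assume k: "k \<in> {l..K}"
    have "expectation (\<lambda>q. indicator {k} (R q) :: real) = expectation (indicator (R -` {k} \<inter> space M))"
      by (intro Bochner_Integration.integral_cong) (auto simp: indicator_def)
    also have "\<dots> = prob (R -` {k} \<inter> space M)"
      by simp
    also have "\<dots> = 1 / real (Suc K - l)"
      unfolding prob using k ne by (simp add: measure_pmf_of_set)
    finally show "expectation (\<lambda>q. indicator {k} (R q) * h k q) = expectation (h k) / real (Suc K - l)"
      using indep_var_lebesgue_integral [OF ind ik int [OF k]] by simp
  qed
  finally show ?thesis by (simp add: sum_divide_distrib)
qed

lemma integrable_inner_square:
  fixes f h :: "'q \<Rightarrow> 'a::euclidean_space"
  assumes [measurable]: "f \<in> borel_measurable M" "h \<in> borel_measurable M"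
    and f: "integrable M (\<lambda>q. (norm (f q))\<^sup>2)" and h: "integrable M (\<lambda>q. (norm (h q))\<^sup>2)"
  shows "integrable M (\<lambda>q. f q \<bullet> h q)"
proof (rule Bochner_Integration.integrable_bound)
  show "integrable M (\<lambda>q. (norm (f q))\<^sup>2 + (norm (h q))\<^sup>2)"
    using f h by (rule Bochner_Integration.integrable_add)
  show "AE q in M. norm (f q \<bullet> h q) \<le> norm ((norm (f q))\<^sup>2 + (norm (h q))\<^sup>2)"
  proof (rule AE_I2)
    fix q
    have "0 \<le> (norm (f q) - norm (h q))\<^sup>2 + (norm (f q))\<^sup>2 + (norm (h q))\<^sup>2" by simp
    then have "norm (f q) * norm (h q) \<le> (norm (f q))\<^sup>2 + (norm (h q))\<^sup>2"
      by (simp add: power2_diff)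
    then show "norm (f q \<bullet> h q) \<le> norm ((norm (f q))\<^sup>2 + (norm (h q))\<^sup>2)"
      using Cauchy_Schwarz_ineq2 [of "f q" "h q"] by simp
  qed
qed measurable

section \<open>The sampled scheme\<close>

text \<open>
  In the application, \<open>\<phi>\<close> is the implicit integrand composed with the projection onto
  \<open>X + \<eta>0 B\<close>, which extends it to a Lipschitz function on the whole space.
\<close>

locale zeroth_order_sampling = M: prob_space M + Q: prob_space Q
  for M :: "'w measure" and Q :: "'q measure" +
  fixes \<phi> :: "'a::euclidean_space \<Rightarrow> 'w \<Rightarrow> real" and lip :: "'w \<Rightarrow> real" and X :: "'a set"
    and \<eta> \<gamma> :: real and x0 :: 'a and v :: "nat \<Rightarrow> nat \<Rightarrow> 'q \<Rightarrow> 'a" and w :: "nat \<Rightarrow> nat \<Rightarrow> 'q \<Rightarrow> 'w"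
    and x :: "nat \<Rightarrow> 'q \<Rightarrow> 'a"
  assumes \<phi>_integrable: "\<And>z. integrable M (\<phi> z)"
    and \<phi>_lipschitz: "\<And>\<omega>. \<omega> \<in> space M \<Longrightarrow> (lip \<omega>)-lipschitz_on UNIV (\<lambda>z. \<phi> z \<omega>)"
    and lip_measurable [measurable]: "lip \<in> borel_measurable M"
    and lip_square_integrable: "integrable M (\<lambda>\<omega>. (lip \<omega>)\<^sup>2)"
    and U: "assumption_U M Q \<eta> v w"
    and X: "X \<noteq> {}" "closed X" "bounded X" "convex X"
    and \<eta>: "0 < \<eta>" and \<gamma>: "0 < \<gamma>" and x0: "x0 \<in> X"
    and x_0: "x 0 q = x0"
    and x_Suc: "q \<in> space Q \<Longrightarrow> x (Suc k) q =
      closest_point X (x k q - \<gamma> *\<^sub>R ((1 / real (batch_size k)) *\<^sub>R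
        (\<Sum>j = 1..batch_size k. (real DIM('a) * (\<phi> (x k q + v k j q) (w k j q) - \<phi> (x k q) (w k j q))
           / (norm (v k j q) * \<eta>)) *\<^sub>R v k j q)))"
begin

section \<open>Mean and size of a single estimate\<close>

definition L0 :: real where "L0 = rms M lip"

definition H :: "'a \<Rightarrow> real" where "H z = (\<integral>\<omega>. \<phi> z \<omega> \<partial>M)"

definition g :: "'a \<Rightarrow> 'a" where "g = spherical_gradient \<eta> H"

definition estimate :: "'a \<Rightarrow> 'a \<times> 'w \<Rightarrow> 'a" where
  "estimate z \<xi> = (real DIM('a) * (\<phi> (z + fst \<xi>) (snd \<xi>) - \<phi> z (snd \<xi>)) / (norm (fst \<xi>) * \<eta>)) *\<^sub>R fst \<xi>"

definition sample :: "nat \<Rightarrow> nat \<Rightarrow> 'q \<Rightarrow> 'a \<times> 'w" where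
  "sample k j q = (v k j q, w k j q)"

definition law :: "('a \<times> 'w) measure" where "law = uniform_sphere \<eta> \<Otimes>\<^sub>M M"

lemma lip_integrable: "integrable M lip"
  by (rule M.square_integrable_imp_integrable [OF lip_measurable lip_square_integrable])

lemma L0_nonneg: "0 \<le> L0"
  by (simp add: L0_def rms_def)

lemma L0_square: "L0\<^sup>2 = (\<integral>\<omega>. (lip \<omega>)\<^sup>2 \<partial>M)"
  by (simp add: L0_def rms_def)

text \<open>Jensen's inequality, read off from the variance being nonnegative; it makes
  \<open>L0\<close> a Lipschitz constant of \<open>H\<close>.\<close>

lemma expectation_lip_le: "(\<integral>\<omega>. lip \<omega> \<partial>M) \<le> L0"
proof -
  have "0 \<le> M.variance lip" by simp
  also have "M.variance lip = (\<integral>\<omega>. (lip \<omega>)\<^sup>2 \<partial>M) - (\<integral>\<omega>. lip \<omega> \<partial>M)\<^sup>2"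
    by (rule M.variance_eq [OF lip_integrable lip_square_integrable])
  finally show ?thesis unfolding L0_def rms_def by (intro real_le_rsqrt) simp
qed

lemma H_lipschitz: "L0-lipschitz_on UNIV H"
proof (rule lipschitz_onI [OF _ L0_nonneg])
  fix y z
  have "dist (H y) (H z) = \<bar>\<integral>\<omega>. \<phi> y \<omega> - \<phi> z \<omega> \<partial>M\<bar>"
    unfolding H_def dist_real_def by (subst Bochner_Integration.integral_diff [OF \<phi>_integrable \<phi>_integrable]) simp
  also have "\<dots> \<le> (\<integral>\<omega>. lip \<omega> * dist y z \<partial>M)"
  proof (rule order_trans [OF integral_abs_bound integral_mono])
    show "\<bar>\<phi> y \<omega> - \<phi> z \<omega>\<bar> \<le> lip \<omega> * dist y z" if "\<omega> \<in> space M" for \<omega>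
      using lipschitz_onD [OF \<phi>_lipschitz [OF that], of y z] by (simp add: dist_real_def)
  qed (intro integrable_abs Bochner_Integration.integrable_diff \<phi>_integrable integrable_mult_left lip_integrable)+
  also have "\<dots> \<le> L0 * dist y z"
    using expectation_lip_le by (simp add: mult_right_mono)
  finally show "dist (H y) (H z) \<le> L0 * dist y z" .
qed

lemma H_measurable [measurable]: "H \<in> borel_measurable borel"
  by (rule borel_measurable_lipschitz_UNIV [OF H_lipschitz])

lemma \<phi>_measurable [measurable]: "(\<lambda>(z, \<omega>). \<phi> z \<omega>) \<in> borel_measurable (borel \<Otimes>\<^sub>M M)"
  using \<phi>_integrable \<phi>_lipschitz
  by (intro borel_measurable_Caratheodory) (auto intro: lipschitz_on_continuous_on)

lemma estimate_measurable [measurable]: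
  "(\<lambda>(z, \<xi>). estimate z \<xi>) \<in> borel_measurable (borel \<Otimes>\<^sub>M (borel \<Otimes>\<^sub>M M))"
proof -
  have "(\<lambda>p. \<phi> (fst p) (snd (snd p))) \<in> borel_measurable (borel \<Otimes>\<^sub>M (borel \<Otimes>\<^sub>M M :: ('a \<times> 'w) measure))"
    using measurable_compose [OF _ \<phi>_measurable, of "\<lambda>p. (fst p, snd (snd p))"] by simp
  moreover have "(\<lambda>p. \<phi> (fst p + fst (snd p)) (snd (snd p))) \<in> borel_measurable (borel \<Otimes>\<^sub>M (borel \<Otimes>\<^sub>M M :: ('a \<times> 'w) measure))"
    using measurable_compose [OF _ \<phi>_measurable, of "\<lambda>p. (fst p + fst (snd p), snd (snd p))"] by simp
  ultimately show ?thesis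
    unfolding estimate_def case_prod_beta' by measurable
qed

lemma sets_law [measurable_cong, simp]: "sets law = sets (borel \<Otimes>\<^sub>M M)"
  unfolding law_def by (intro sets_pair_measure_cong) simp_all

sublocale uniform: prob_space "uniform_sphere \<eta> :: 'a measure"
  by (rule prob_space_uniform_sphere)

sublocale uniform_M: pair_prob_space "uniform_sphere \<eta> :: 'a measure" M ..

lemma prob_space_law: "prob_space law"
  unfolding law_def by (rule uniform_M.prob_space_axioms)

lemma norm_estimate_le:
  assumes "snd \<xi> \<in> space M" "norm (fst \<xi>) \<le> \<eta>"
  shows "norm (estimate z \<xi>) \<le> real DIM('a) * lip (snd \<xi>)"
  unfolding estimate_def using norm_finite_difference_le [OF \<phi>_lipschitz [OF assms(1)] \<eta> assms(2)] .

lemma estimate_section_measurable [measurable]: "estimate z \<in> borel_measurable (borel \<Otimes>\<^sub>M M)"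
  using measurable_Pair2 [OF estimate_measurable, of z] by simp

lemma integrable_lip_law: "integrable law (\<lambda>\<xi>. lip (snd \<xi>))"
  unfolding law_def
proof (rule uniform_M.Fubini_integrable)
  show "integrable (uniform_sphere \<eta>) (\<lambda>v::'a. \<integral>\<omega>. norm (lip (snd (v, \<omega>))) \<partial>M)" by simp
  show "AE v::'a in uniform_sphere \<eta>. integrable M (\<lambda>\<omega>. lip (snd (v, \<omega>)))"
    using lip_integrable by simp
qed measurable

lemma integral_lip_law: "(\<integral>\<xi>. lip (snd \<xi>) \<partial>law) = (\<integral>\<omega>. lip \<omega> \<partial>M)"
  using uniform_M.integral_fst' [OF integrable_lip_law [unfolded law_def]] by (simp add: law_def uniform.prob_space [simplified])

lemma AE_norm_estimate_le: "AE \<xi> in law. norm (estimate z \<xi>) \<le> real DIM('a) * lip (snd \<xi>)"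
  unfolding law_def
proof (rule uniform_M.AE_pair_measure)
  show "{\<xi> \<in> space (uniform_sphere \<eta> \<Otimes>\<^sub>M M). norm (estimate z \<xi>) \<le> real DIM('a) * lip (snd \<xi>)} \<in> sets (uniform_sphere \<eta> \<Otimes>\<^sub>M M)"
    by measurable
  show "AE v in uniform_sphere \<eta>. AE \<omega> in M. norm (estimate z (v, \<omega>)) \<le> real DIM('a) * lip (snd (v, \<omega>))"
    using AE_uniform_sphere_norm_le [OF \<eta>, where 'a = 'a]
    by eventually_elim (rule AE_I2, use norm_estimate_le [where z = z] in fastforce)
qed

lemma integrable_estimate: "integrable law (estimate z)"
proof (rule Bochner_Integration.integrable_bound)
  show "integrable law (\<lambda>\<xi>. real DIM('a) * lip (snd \<xi>))" using integrable_lip_law by simp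
  show "AE \<xi> in law. norm (estimate z \<xi>) \<le> norm (real DIM('a) * lip (snd \<xi>))"
    using AE_norm_estimate_le [of z] by eventually_elim (auto intro: order_trans [OF _ abs_ge_self])
qed measurable

text \<open>Unbiasedness. Integrating over the replicate first turns \<open>\<phi>\<close> into
  \<open>H\<close>, and what remains is the sphere average defining
  \<open>spherical_gradient\<close>.\<close>

lemma g_eq: "g z = (\<integral>\<xi>. estimate z \<xi> \<partial>law)"
proof -
  have "(\<integral>\<xi>. estimate z \<xi> \<partial>law) = (\<integral>v. (\<integral>\<omega>. estimate z (v, \<omega>) \<partial>M) \<partial>uniform_sphere \<eta>)"
    unfolding law_def by (rule uniform_M.integral_fst' [symmetric]) (rule integrable_estimate [unfolded law_def])
  also have "(\<lambda>v. \<integral>\<omega>. estimate z (v, \<omega>) \<partial>M) = (\<lambda>v. (real DIM('a) * (H (z + v) - H z) / (norm v * \<eta>)) *\<^sub>R v)"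
  proof
    fix v
    have "(\<integral>\<omega>. estimate z (v, \<omega>) \<partial>M) = (\<integral>\<omega>. ((\<phi> (z + v) \<omega> - \<phi> z \<omega>) * (real DIM('a) / (norm v * \<eta>))) *\<^sub>R v \<partial>M)"
      by (simp add: estimate_def ac_simps)
    also have "\<dots> = ((H (z + v) - H z) * (real DIM('a) / (norm v * \<eta>))) *\<^sub>R v"
      unfolding H_def using \<phi>_integrable by simp
    finally show "(\<integral>\<omega>. estimate z (v, \<omega>) \<partial>M) = (real DIM('a) * (H (z + v) - H z) / (norm v * \<eta>)) *\<^sub>R v"
      by (simp add: ac_simps)
  qed
  finally show ?thesis unfolding g_def spherical_gradient_def ..
qed

lemma norm_g_le: "norm (g z) \<le> real DIM('a) * L0"
proof -
  have "norm (g z) \<le> (\<integral>\<xi>. norm (estimate z \<xi>) \<partial>law)"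
    unfolding g_eq by (rule integral_norm_bound)
  also have "\<dots> \<le> (\<integral>\<xi>. real DIM('a) * lip (snd \<xi>) \<partial>law)"
    using integrable_estimate integrable_lip_law AE_norm_estimate_le by (intro integral_mono_AE) auto
  also have "\<dots> \<le> real DIM('a) * L0"
    using expectation_lip_le by (simp add: integral_lip_law)
  finally show ?thesis .
qed

lemma g_measurable [measurable]: "g \<in> borel_measurable borel"
proof -
  interpret law: prob_space law by (rule prob_space_law)
  show ?thesis
    unfolding g_eq [abs_def] using estimate_measurable by (intro law.borel_measurable_lebesgue_integral) simp
qed

section \<open>Sigma-algebras of draws and product laws\<close>

definition info :: "draw set \<Rightarrow> 'q measure" where
  "info S = sigma (space Q) (\<Union>d\<in>S. draw_events M Q v w d)"

definition past :: "nat \<Rightarrow> draw set" where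
  "past k = (\<Union>i<k. \<Union>j\<in>{1..batch_size i}. {Direction i j, Replicate i j})"

lemma draw_events_subset: "draw_events M Q v w d \<subseteq> Pow (space Q)"
proof (cases d)
  case (Direction k j)
  then show ?thesis
    using sets.space_closed [of "vimage_algebra (space Q) (v k j) borel"] by (simp add: draw_events_def)
next
  case (Replicate k j)
  then show ?thesis
    using sets.space_closed [of "vimage_algebra (space Q) (w k j) M"] by (simp add: draw_events_def)
qed

lemma space_info [simp]: "space (info S) = space Q"
  unfolding info_def by (rule space_measure_of) (use draw_events_subset in blast)

lemma sets_info: "sets (info S) = sigma_sets (space Q) (\<Union>d\<in>S. draw_events M Q v w d)"
  unfolding info_def by (rule sets_measure_of) (use draw_events_subset in blast)

lemma measurable_info_mono:
  assumes "f \<in> measurable (info S) N" "S \<subseteq> T"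
  shows "f \<in> measurable (info T) N"
proof -
  have "sets (info S) \<subseteq> sets (info T)"
    unfolding sets_info using assms(2) by (intro sigma_sets_mono') auto
  then show ?thesis using assms(1) by (auto simp: measurable_def)
qed

lemma
  assumes "j \<in> {1..batch_size k}"
  shows v_measurable [measurable]: "v k j \<in> borel_measurable Q"
    and v_sphere: "v k j \<in> space Q \<rightarrow> sphere 0 \<eta>"
    and v_law: "distr Q borel (v k j) = uniform_sphere \<eta>"
    and w_measurable [measurable]: "w k j \<in> measurable Q M"
    and w_law: "distr Q M (w k j) = M"
  using U assms unfolding assumption_U_def by auto

lemma v_info:
  assumes "Direction k j \<in> S"
  shows "v k j \<in> borel_measurable (info S)"
proof (rule measurableI)
  fix A :: "'a set" assume "A \<in> sets borel"
  then have "v k j -` A \<inter> space Q \<in> draw_events M Q v w (Direction k j)"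
    by (auto simp: draw_events_def intro: in_vimage_algebra)
  then show "v k j -` A \<inter> space (info S) \<in> sets (info S)"
    using assms by (auto simp: sets_info)
qed simp

lemma w_info:
  assumes "Replicate k j \<in> S" and j: "j \<in> {1..batch_size k}"
  shows "w k j \<in> measurable (info S) M"
proof (rule measurableI)
  show "w k j q \<in> space M" if "q \<in> space (info S)" for q
    using measurable_space [OF w_measurable [OF j]] that by simp
  fix A assume "A \<in> sets M"
  then have "w k j -` A \<inter> space Q \<in> draw_events M Q v w (Replicate k j)"
    by (auto simp: draw_events_def intro: in_vimage_algebra)
  then show "w k j -` A \<inter> space (info S) \<in> sets (info S)"
    using assms by (auto simp: sets_info)
qed

lemma sample_info:
  assumes "{Direction k j, Replicate k j} \<subseteq> S" and j: "j \<in> {1..batch_size k}"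
  shows "sample k j \<in> measurable (info S) (borel \<Otimes>\<^sub>M M)"
  unfolding sample_def [abs_def] using assms by (intro measurable_Pair v_info w_info) auto

lemma sample_measurable [measurable]:
  "j \<in> {1..batch_size k} \<Longrightarrow> sample k j \<in> measurable Q (borel \<Otimes>\<^sub>M M)"
  unfolding sample_def [abs_def] by measurable

text \<open>Each draw generates a sigma-algebra, which is intersection-stable, so mutual
  independence passes to the joins over disjoint sets of draws. Later independence claims about
  draws thereby reduce to disjointness of index sets.\<close>

lemma indep_info:
  assumes "S \<subseteq> draws" "T \<subseteq> draws" "S \<inter> T = {}"
  shows "Q.indep_set (sets (info S)) (sets (info T))"
proof -
  have "Q.indep_sets (draw_events M Q v w) draws"
    using U by (simp add: assumption_U_def)
  then have "Q.indep_sets (draw_events M Q v w) (\<Union>b\<in>UNIV. case_bool S T b)"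
    by (rule Q.indep_sets_mono_index [rotated]) (use assms in \<open>auto split: bool.splits\<close>)
  then have "Q.indep_sets (\<lambda>b. sigma_sets (space Q) (\<Union>d\<in>case_bool S T b. draw_events M Q v w d)) UNIV"
  proof (rule Q.indep_sets_collect_sigma)
    show "Int_stable (draw_events M Q v w d)" for d
      by (cases d) (auto simp: draw_events_def intro!: sets.Int_stable)
    show "disjoint_family_on (case_bool S T) UNIV"
      using assms(3) by (auto simp: disjoint_family_on_def split: bool.splits)
  qed
  moreover have "(\<lambda>b. sigma_sets (space Q) (\<Union>d\<in>case_bool S T b. draw_events M Q v w d))
      = case_bool (sets (info S)) (sets (info T))"
    by (auto simp: fun_eq_iff sets_info split: bool.split)
  ultimately show ?thesis by (simp add: Q.indep_set_def)
qed

lemma draw_pair_subset: "j \<in> {1..batch_size k} \<Longrightarrow> {Direction k j, Replicate k j} \<subseteq> draws"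
  by (auto simp: draws_def)

lemma past_subset: "past k \<subseteq> draws"
  by (auto simp: past_def draws_def)

lemma sample_law:
  assumes j: "j \<in> {1..batch_size k}"
  shows "distr Q (borel \<Otimes>\<^sub>M M) (sample k j) = law"
  unfolding sample_def [abs_def] law_def v_law [OF j, symmetric]
  by (subst (2) w_law [OF j, symmetric], subst Q.distr_pair_subalgebras [OF indep_info [of "{Direction k j}" "{Replicate k j}"]])
     (use draw_pair_subset [OF j] j in \<open>auto intro: v_info w_info\<close>)

lemma x_in_X: "q \<in> space Q \<Longrightarrow> x k q \<in> X"
  using X closest_point_in_set x0 by (cases k) (auto simp: x_0 x_Suc)

lemma closest_point_measurable [measurable]: "closest_point X \<in> borel_measurable borel"
  using X by (intro borel_measurable_continuous_onI continuous_on_closest_point) auto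

lemma x_Suc_estimate:
  assumes "q \<in> space Q"
  shows "x (Suc k) q = closest_point X (x k q - \<gamma> *\<^sub>R ((1 / real (batch_size k)) *\<^sub>R
           (\<Sum>j = 1..batch_size k. estimate (x k q) (sample k j q))))"
  using x_Suc [OF assms] by (simp add: estimate_def sample_def)

text \<open>\<open>past k\<close> stops before batch \<open>k\<close>, the batch consumed in forming
  \<open>x (Suc k)\<close>. The iterate \<open>x k\<close> is thus independent of all samples used
  to move away from it.\<close>

lemma x_info: "x k \<in> borel_measurable (info (past k))"
proof (induction k)
  case 0
  then show ?case by (simp add: x_0 [abs_def])
next
  case (Suc k)
  have [measurable]: "x k \<in> borel_measurable (info (past (Suc k)))"
    by (rule measurable_info_mono [OF Suc]) (auto simp: past_def)
  have "sample k j \<in> measurable (info (past (Suc k))) (borel \<Otimes>\<^sub>M M)" if "j \<in> {1..batch_size k}" for j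
    using that by (intro sample_info) (auto simp: past_def)
  then have "(\<lambda>q. estimate (x k q) (sample k j q)) \<in> borel_measurable (info (past (Suc k)))" if "j \<in> {1..batch_size k}" for j
    using measurable_compose [OF _ estimate_measurable, of "\<lambda>q. (x k q, sample k j q)" "info (past (Suc k))"] that
    by simp
  then have "(\<lambda>q. closest_point X (x k q - \<gamma> *\<^sub>R ((1 / real (batch_size k)) *\<^sub>R
           (\<Sum>j = 1..batch_size k. estimate (x k q) (sample k j q))))) \<in> borel_measurable (info (past (Suc k)))"
    by (intro measurable_compose [OF _ closest_point_measurable] borel_measurable_diff
        borel_measurable_scaleR borel_measurable_sum measurable_const) auto
  then show ?case
    by (subst measurable_cong) (auto simp: x_Suc_estimate)
qed

lemma info_measurable:
  assumes "f \<in> measurable (info S) N" "S \<subseteq> draws"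
  shows "f \<in> measurable Q N"
proof -
  \<comment> \<open>Pairing \<open>S\<close> with the empty set of draws serves only to read off
    that \<open>info S\<close> consists of events.\<close>
  have "sets (info S) \<subseteq> sets Q"
    using Q.indep_setD_ev1 [OF indep_info [of S "{}"]] assms by simp
  then show ?thesis using assms(1) by (auto simp: measurable_def)
qed

lemma x_measurable [measurable]: "x k \<in> borel_measurable Q"
  using info_measurable [OF x_info past_subset] .

text \<open>A non-integrable integrand is covered because its integral is \<open>0\<close> by convention.\<close>

lemma expectation_inner_increment:
  assumes a: "a \<in> borel_measurable (info S)" and z: "z \<in> borel_measurable (info S)"
    and j: "j \<in> {1..batch_size k}" and S: "S \<subseteq> draws" "S \<inter> {Direction k j, Replicate k j} = {}"
  shows "(\<integral>q. a q \<bullet> (estimate (z q) (sample k j q) - g (z q)) \<partial>Q) = 0"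
proof -
  interpret law: prob_space law by (rule prob_space_law)
  note [measurable] = info_measurable [OF a S(1)] info_measurable [OF z S(1)] sample_measurable [OF j]
  let ?P = "distr Q (borel \<Otimes>\<^sub>M borel) (\<lambda>q. (a q, z q))"
  let ?f = "\<lambda>p. fst (fst p) \<bullet> (estimate (snd (fst p)) (snd p) - g (snd (fst p)))"
  interpret P: prob_space ?P by (rule Q.prob_space_distr) simp
  interpret PL: pair_prob_space ?P law ..
  have "(\<lambda>p. estimate (snd (fst p)) (snd p)) \<in> borel_measurable ((borel \<Otimes>\<^sub>M borel) \<Otimes>\<^sub>M (borel \<Otimes>\<^sub>M M))"
    using measurable_compose [OF _ estimate_measurable, of "\<lambda>p. (snd (fst p), snd p)"
        "((borel :: 'a measure) \<Otimes>\<^sub>M borel) \<Otimes>\<^sub>M (borel \<Otimes>\<^sub>M M)"] by simp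
  then have f [measurable]: "?f \<in> borel_measurable ((borel \<Otimes>\<^sub>M borel) \<Otimes>\<^sub>M (borel \<Otimes>\<^sub>M M))"
    by measurable
  \<comment> \<open>Independence is used in this form: the pair of past variables and the fresh
    sample have a product law, so the sample can be integrated first with \<open>a\<close> and
    \<open>z\<close> frozen, and \<open>g_eq\<close> makes the inner integral zero.\<close>
  have joint: "distr Q ((borel \<Otimes>\<^sub>M borel) \<Otimes>\<^sub>M (borel \<Otimes>\<^sub>M M)) (\<lambda>q. ((a q, z q), sample k j q)) = ?P \<Otimes>\<^sub>M law"
    unfolding sample_law [OF j, symmetric]
    using S draw_pair_subset [OF j] a z j
    by (intro Q.distr_pair_subalgebras [OF indep_info [of S "{Direction k j, Replicate k j}"]] measurable_Pair sample_info) auto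
  have "(\<integral>q. a q \<bullet> (estimate (z q) (sample k j q) - g (z q)) \<partial>Q) = (\<integral>p. ?f p \<partial>(?P \<Otimes>\<^sub>M law))"
    unfolding joint [symmetric] by (subst integral_distr) auto
  also have "\<dots> = 0"
  proof (cases "integrable (?P \<Otimes>\<^sub>M law) ?f")
    case True
    have "(\<integral>\<xi>. ?f (p, \<xi>) \<partial>law) = 0" for p
    proof -
      have "(\<integral>\<xi>. ?f (p, \<xi>) \<partial>law) = fst p \<bullet> (\<integral>\<xi>. estimate (snd p) \<xi> - g (snd p) \<partial>law)"
        using integrable_estimate by (subst integral_inner_right [symmetric]) auto
      also have "(\<integral>\<xi>. estimate (snd p) \<xi> - g (snd p) \<partial>law) = 0"
        using integrable_estimate [of "snd p"] by (simp add: g_eq law.prob_space)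
      finally show ?thesis by simp
    qed
    then show ?thesis using PL.integral_fst' [OF True] by simp
  qed (rule not_integrable_integral_eq)
  finally show ?thesis .
qed

section \<open>Variance of the batch mean\<close>

definition increment :: "nat \<Rightarrow> nat \<Rightarrow> 'q \<Rightarrow> 'a" where
  "increment k j q = estimate (x k q) (sample k j q) - g (x k q)"

definition noise :: "nat \<Rightarrow> 'q \<Rightarrow> 'a" where
  "noise k q = (1 / real (batch_size k)) *\<^sub>R (\<Sum>j = 1..batch_size k. estimate (x k q) (sample k j q)) - g (x k q)"

definition res :: "'a \<Rightarrow> 'a" where
  "res z = (1 / \<gamma>) *\<^sub>R (z - closest_point X (z - \<gamma> *\<^sub>R g z))"

lemma estimate_sample_measurable [measurable]:
  "j \<in> {1..batch_size k} \<Longrightarrow> (\<lambda>q. estimate (x k q) (sample k j q)) \<in> borel_measurable Q"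
  using measurable_compose [OF _ estimate_measurable, of "\<lambda>q. (x k q, sample k j q)" Q] by simp

lemma increment_measurable [measurable]:
  "j \<in> {1..batch_size k} \<Longrightarrow> increment k j \<in> borel_measurable Q"
  unfolding increment_def [abs_def] by measurable

lemma increment_info:
  assumes "past k \<union> {Direction k j, Replicate k j} \<subseteq> S" and j: "j \<in> {1..batch_size k}"
  shows "increment k j \<in> borel_measurable (info S)"
proof -
  have [measurable]: "x k \<in> borel_measurable (info S)" "sample k j \<in> measurable (info S) (borel \<Otimes>\<^sub>M M)"
    using assms by (auto intro: measurable_info_mono [OF x_info] sample_info)
  have "(\<lambda>q. estimate (x k q) (sample k j q)) \<in> borel_measurable (info S)"
    using measurable_compose [OF _ estimate_measurable, of "\<lambda>q. (x k q, sample k j q)" "info S"] by simp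
  then show ?thesis unfolding increment_def [abs_def] by measurable
qed

lemma
  assumes j: "j \<in> {1..batch_size k}"
  shows integrable_lip_w: "integrable Q (\<lambda>q. (lip (w k j q))\<^sup>2)"
    and integral_lip_w: "(\<integral>q. (lip (w k j q))\<^sup>2 \<partial>Q) = L0\<^sup>2"
proof -
  note [measurable] = w_measurable [OF j]
  show "integrable Q (\<lambda>q. (lip (w k j q))\<^sup>2)"
    using lip_square_integrable by (subst (asm) w_law [OF j, symmetric]) (simp add: integrable_distr_eq)
  show "(\<integral>q. (lip (w k j q))\<^sup>2 \<partial>Q) = L0\<^sup>2"
    unfolding L0_square using integral_distr [of "w k j" Q M "\<lambda>\<omega>. (lip \<omega>)\<^sup>2"] by (simp add: w_law [OF j])
qed

lemma norm_estimate_sample_le: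
  assumes "j \<in> {1..batch_size k}" "q \<in> space Q"
  shows "(norm (estimate z (sample k j q)))\<^sup>2 \<le> (real DIM('a))\<^sup>2 * (lip (w k j q))\<^sup>2"
proof -
  have "norm (estimate z (sample k j q)) \<le> real DIM('a) * lip (snd (sample k j q))"
    using measurable_space [OF w_measurable [OF assms(1)] assms(2)] v_sphere [OF assms(1)] assms(2)
    by (intro norm_estimate_le) (auto simp: sample_def Pi_iff)
  then have "(norm (estimate z (sample k j q)))\<^sup>2 \<le> (real DIM('a) * lip (w k j q))\<^sup>2"
    by (intro power_mono) (auto simp: sample_def)
  then show ?thesis by (simp add: power_mult_distrib)
qed

lemma integrable_estimate_square:
  assumes j: "j \<in> {1..batch_size k}"
  shows "integrable Q (\<lambda>q. (norm (estimate (x k q) (sample k j q)))\<^sup>2)"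
proof (rule Bochner_Integration.integrable_bound)
  show "integrable Q (\<lambda>q. (real DIM('a))\<^sup>2 * (lip (w k j q))\<^sup>2)"
    using integrable_lip_w [OF j] by simp
qed (use norm_estimate_sample_le [OF j] j in \<open>auto intro!: AE_I2\<close>)

lemma expectation_estimate_square_le:
  assumes j: "j \<in> {1..batch_size k}"
  shows "(\<integral>q. (norm (estimate (x k q) (sample k j q)))\<^sup>2 \<partial>Q) \<le> (real DIM('a) * L0)\<^sup>2"
proof -
  have "(\<integral>q. (norm (estimate (x k q) (sample k j q)))\<^sup>2 \<partial>Q) \<le> (\<integral>q. (real DIM('a))\<^sup>2 * (lip (w k j q))\<^sup>2 \<partial>Q)"
    using integrable_estimate_square [OF j] integrable_lip_w [OF j] norm_estimate_sample_le [OF j]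
    by (intro integral_mono) auto
  then show ?thesis using integral_lip_w [OF j] by (simp add: power_mult_distrib)
qed

lemma g_square_le: "(norm (g z))\<^sup>2 \<le> (real DIM('a) * L0)\<^sup>2"
  using norm_g_le [of z] by (intro power_mono) auto

lemma integrable_g_square: "integrable Q (\<lambda>q. (norm (g (x k q)))\<^sup>2)"
  using g_square_le by (intro Q.integrable_const_bound [where B = "(real DIM('a) * L0)\<^sup>2"]) auto

lemma integrable_increment_square:
  assumes j: "j \<in> {1..batch_size k}"
  shows "integrable Q (\<lambda>q. (norm (increment k j q))\<^sup>2)"
proof -
  note [measurable] = estimate_sample_measurable [OF j]
  let ?e = "\<lambda>q. estimate (x k q) (sample k j q)"
  have "integrable Q (\<lambda>q. (norm (?e q))\<^sup>2 - 2 * (?e q \<bullet> g (x k q)) + (norm (g (x k q)))\<^sup>2)"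
    using integrable_estimate_square [OF j] integrable_g_square [of k]
    by (intro Bochner_Integration.integrable_add Bochner_Integration.integrable_diff integrable_mult_right
        integrable_inner_square) auto
  then show ?thesis
    unfolding increment_def power2_norm_eq_inner by (simp add: inner_diff_left inner_diff_right inner_commute algebra_simps)
qed

text \<open>A variance is at most the second moment. The cross term with \<open>g (x k q)\<close>
  has mean zero because both \<open>x k\<close> and \<open>g (x k)\<close> are known from
  \<open>past k\<close>.\<close>

lemma expectation_increment_square_le:
  assumes j: "j \<in> {1..batch_size k}"
  shows "(\<integral>q. (norm (increment k j q))\<^sup>2 \<partial>Q) \<le> (real DIM('a) * L0)\<^sup>2"
proof -
  note [measurable] = estimate_sample_measurable [OF j] increment_measurable [OF j]
  let ?e = "\<lambda>q. estimate (x k q) (sample k j q)"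
  have i1: "integrable Q (\<lambda>q. g (x k q) \<bullet> increment k j q)"
    using integrable_increment_square [OF j] integrable_g_square by (intro integrable_inner_square) auto
  have eq: "(norm (?e q))\<^sup>2 = (norm (increment k j q))\<^sup>2 + 2 * (g (x k q) \<bullet> increment k j q) + (norm (g (x k q)))\<^sup>2" for q
    unfolding increment_def power2_norm_eq_inner by (simp add: inner_diff_left inner_diff_right inner_commute algebra_simps)
  have "(\<integral>q. g (x k q) \<bullet> increment k j q \<partial>Q) = 0"
    unfolding increment_def
    using x_info [of k] j past_subset
    by (intro expectation_inner_increment [where S = "past k"] measurable_compose [OF x_info g_measurable])
       (auto simp: past_def)
  then have "(\<integral>q. (norm (?e q))\<^sup>2 \<partial>Q) = (\<integral>q. (norm (increment k j q))\<^sup>2 \<partial>Q) + (\<integral>q. (norm (g (x k q)))\<^sup>2 \<partial>Q)"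
    unfolding eq using i1 integrable_increment_square [OF j] integrable_g_square [of k] by simp
  moreover have "0 \<le> (\<integral>q. (norm (g (x k q)))\<^sup>2 \<partial>Q)" by simp
  ultimately show ?thesis using expectation_estimate_square_le [OF j] by linarith
qed

text \<open>One position is added to the past: relative to \<open>past k\<close> together with the
  draws of position \<open>i\<close>, \<open>increment k i\<close> is known while the sample of
  position \<open>j\<close> is still fresh.\<close>

lemma expectation_increment_uncorrelated:
  assumes i: "i \<in> {1..batch_size k}" and j: "j \<in> {1..batch_size k}" and "i \<noteq> j"
  shows "(\<integral>q. increment k i q \<bullet> increment k j q \<partial>Q) = 0"
proof -
  let ?S = "past k \<union> {Direction k i, Replicate k i}"
  have "increment k i \<in> borel_measurable (info ?S)" using i by (intro increment_info) auto
  moreover have "x k \<in> borel_measurable (info ?S)" by (rule measurable_info_mono [OF x_info]) auto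
  ultimately show ?thesis
    unfolding increment_def [of k j] using j assms past_subset [of k] draw_pair_subset [OF i]
    by (intro expectation_inner_increment [where S = ?S]) (auto simp: past_def)
qed

lemma
  shows integrable_noise_square: "integrable Q (\<lambda>q. (norm (noise k q))\<^sup>2)"
    and expectation_noise_square_le: "(\<integral>q. (norm (noise k q))\<^sup>2 \<partial>Q) \<le> (real DIM('a) * L0)\<^sup>2 / (real k + 1)"
proof -
  let ?N = "batch_size k"
  have N: "0 < real ?N" by (simp add: batch_size_def)
  have noise: "noise k q = (1 / real ?N) *\<^sub>R (\<Sum>j = 1..?N. increment k j q)" for q
    using N by (simp add: noise_def increment_def sum_subtractf scaleR_diff_right scaleR_sum_right sum_constant_scaleR)
  have eq: "(norm (noise k q))\<^sup>2 = (1 / real ?N)\<^sup>2 * (\<Sum>i = 1..?N. \<Sum>j = 1..?N. increment k i q \<bullet> increment k j q)" for q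
  proof -
    have "(norm (noise k q))\<^sup>2 = (1 / real ?N)\<^sup>2 * (norm (\<Sum>j = 1..?N. increment k j q))\<^sup>2"
      unfolding noise norm_scaleR power_mult_distrib by simp
    then show ?thesis unfolding power2_norm_eq_inner inner_sum_left unfolding inner_sum_right .
  qed
  have int: "integrable Q (\<lambda>q. increment k i q \<bullet> increment k j q)" if "i \<in> {1..?N}" "j \<in> {1..?N}" for i j
    using that by (intro integrable_inner_square integrable_increment_square increment_measurable)
  show "integrable Q (\<lambda>q. (norm (noise k q))\<^sup>2)"
    unfolding eq by (intro integrable_mult_right Bochner_Integration.integrable_sum int)
  have "(\<integral>q. (norm (noise k q))\<^sup>2 \<partial>Q)
      = (1 / real ?N)\<^sup>2 * (\<Sum>i = 1..?N. \<Sum>j = 1..?N. \<integral>q. increment k i q \<bullet> increment k j q \<partial>Q)"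
    unfolding eq integral_mult_right_zero
    by (subst Bochner_Integration.integral_sum)
       (auto intro!: arg_cong2 [where f = "(*)"] sum.cong Bochner_Integration.integral_sum Bochner_Integration.integrable_sum int)
  \<comment> \<open>Only the diagonal survives: \<open>?N\<close> terms against the squared
    prefactor \<open>1 / ?N\<close>, which leaves one power of the batch size.\<close>
  also have "(\<Sum>i = 1..?N. \<Sum>j = 1..?N. \<integral>q. increment k i q \<bullet> increment k j q \<partial>Q)
      = (\<Sum>i = 1..?N. \<integral>q. (norm (increment k i q))\<^sup>2 \<partial>Q)"
  proof (intro sum.cong refl)
    fix i assume i: "i \<in> {1..?N}"
    have "(\<Sum>j = 1..?N. \<integral>q. increment k i q \<bullet> increment k j q \<partial>Q)
        = (\<Sum>j = 1..?N. if j = i then \<integral>q. (norm (increment k i q))\<^sup>2 \<partial>Q else 0)"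
      using i by (intro sum.cong refl) (auto simp: expectation_increment_uncorrelated power2_norm_eq_inner)
    then show "(\<Sum>j = 1..?N. \<integral>q. increment k i q \<bullet> increment k j q \<partial>Q) = (\<integral>q. (norm (increment k i q))\<^sup>2 \<partial>Q)"
      using i by simp
  qed
  also have "\<dots> \<le> real ?N * (real DIM('a) * L0)\<^sup>2"
    using sum_bounded_above [of "{1..?N}" "\<lambda>i. \<integral>q. (norm (increment k i q))\<^sup>2 \<partial>Q" "(real DIM('a) * L0)\<^sup>2"]
      expectation_increment_square_le by simp
  finally have "(\<integral>q. (norm (noise k q))\<^sup>2 \<partial>Q) \<le> (1 / real ?N)\<^sup>2 * (real ?N * (real DIM('a) * L0)\<^sup>2)"
    by (simp add: mult_left_mono)
  also have "\<dots> = (real DIM('a) * L0)\<^sup>2 / real ?N"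
    using N by (simp add: power2_eq_square field_simps)
  finally show "(\<integral>q. (norm (noise k q))\<^sup>2 \<partial>Q) \<le> (real DIM('a) * L0)\<^sup>2 / (real k + 1)"
    by (simp add: batch_size_def add.commute)
qed

text \<open>A point of \<open>X\<close> is its own projection, so nonexpansiveness applies to
  \<open>z\<close> and \<open>z - \<gamma> *\<^sub>R g z\<close>. Besides integrability, this gives
  the error bound that holds before any iteration is made.\<close>

lemma norm_res_le:
  assumes "z \<in> X"
  shows "norm (res z) \<le> real DIM('a) * L0"
proof -
  have "norm (z - closest_point X (z - \<gamma> *\<^sub>R g z)) \<le> norm (\<gamma> *\<^sub>R g z)"
    using closest_point_lipschitz [OF X(4,2,1), of z "z - \<gamma> *\<^sub>R g z"]
    by (simp add: closest_point_self [OF assms] dist_norm)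
  then have "norm (res z) \<le> norm (g z)"
    unfolding res_def norm_scaleR using \<gamma> by (simp add: divide_le_eq mult.commute)
  then show ?thesis using norm_g_le [of z] by linarith
qed

lemma res_square_le: "z \<in> X \<Longrightarrow> (norm (res z))\<^sup>2 \<le> (real DIM('a) * L0)\<^sup>2"
  using norm_res_le by (intro power_mono) auto

lemma res_measurable [measurable]: "res \<in> borel_measurable borel"
  unfolding res_def [abs_def] by measurable

lemma integrable_res: "integrable Q (\<lambda>q. (norm (res (x k q)))\<^sup>2)"
  using res_square_le [OF x_in_X]
  by (intro Q.integrable_const_bound [where B = "(real DIM('a) * L0)\<^sup>2"]) auto

lemma integrable_H: "integrable Q (\<lambda>q. H (x k q))"
proof -
  obtain r where r: "\<And>z. z \<in> X \<Longrightarrow> norm z \<le> r" using X(3) by (auto simp: bounded_iff)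
  show ?thesis
    using lipschitz_UNIV_growth [OF H_lipschitz r [OF x_in_X]]
    by (intro Q.integrable_const_bound [where B = "\<bar>H 0\<bar> + L0 * r"]) auto
qed

section \<open>Descent along the output window\<close>

lemma step_descent:
  assumes "real DIM('a) * L0 * \<gamma> \<le> \<eta>" and q: "q \<in> space Q"
  shows "(1 - real DIM('a) * L0 * \<gamma> / \<eta>) * (\<gamma> / 4) * (norm (res (x k q)))\<^sup>2
       \<le> smoothed \<eta> H (x k q) - smoothed \<eta> H (x (Suc k) q)
         + \<gamma> * (1 - real DIM('a) * L0 * \<gamma> / (2 * \<eta>)) * (norm (noise k q))\<^sup>2"
proof -
  let ?L = "real DIM('a) * L0 / \<eta>"
  let ?d = "x (Suc k) q - x k q"
  let ?gb = "(1 / real (batch_size k)) *\<^sub>R (\<Sum>j = 1..batch_size k. estimate (x k q) (sample k j q))"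
  have "smoothed \<eta> H (x (Suc k) q) \<le> smoothed \<eta> H (x k q) + g (x k q) \<bullet> ?d + ?L / 2 * (norm ?d)\<^sup>2"
    using smoothed_expansion [OF H_lipschitz \<eta>, of "x k q" ?d] by (simp add: g_def abs_le_iff mult.commute)
  moreover have "?L * \<gamma> \<le> 1" using assms(1) \<eta> by (simp add: divide_le_eq)
  ultimately show ?thesis
    using projected_gradient_step [OF X(4,2) x_in_X [OF q] \<gamma>, where L = ?L and y = "x (Suc k) q" and gb = ?gb
        and S = "smoothed \<eta> H" and g = "g (x k q)"]
      x_Suc_estimate [OF q]
    by (simp add: res_def noise_def mult.commute)
qed

lemma window_bound:
  assumes step: "real DIM('a) * L0 * \<gamma> \<le> \<eta>" and Fstar: "\<And>z. z \<in> X \<Longrightarrow> Fstar \<le> H z" and "l \<le> K"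
  shows "(1 - real DIM('a) * L0 * \<gamma> / \<eta>) * (\<gamma> / 4) * (\<Sum>k = l..K. \<integral>q. (norm (res (x k q)))\<^sup>2 \<partial>Q)
       \<le> (\<integral>q. H (x l q) \<partial>Q) - Fstar + 2 * L0 * \<eta>
         + \<gamma> * (1 - real DIM('a) * L0 * \<gamma> / (2 * \<eta>)) * ((real DIM('a) * L0)\<^sup>2 * (\<Sum>k = l..K. 1 / (real k + 1)))"
    (is "?c * _ \<le> _ + ?b * _")
proof -
  have b: "0 \<le> ?b"
    using step \<eta> \<gamma> L0_nonneg by (simp add: field_simps)
  have "?c * (\<Sum>k = l..K. (norm (res (x k q)))\<^sup>2)
      \<le> H (x l q) - Fstar + 2 * L0 * \<eta> + ?b * (\<Sum>k = l..K. (norm (noise k q))\<^sup>2)" if q: "q \<in> space Q" for q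
  proof -
    let ?S = "\<lambda>k. smoothed \<eta> H (x k q)"
    have "?c * (\<Sum>k = l..K. (norm (res (x k q)))\<^sup>2) \<le> (\<Sum>k = l..K. ?S k - ?S (Suc k) + ?b * (norm (noise k q))\<^sup>2)"
      unfolding sum_distrib_left by (intro sum_mono step_descent step q)
    also have "\<dots> = - (\<Sum>k = l..K. ?S (Suc k) - ?S k) + ?b * (\<Sum>k = l..K. (norm (noise k q))\<^sup>2)"
      by (simp add: sum.distrib sum_subtractf sum_distrib_left)
    \<comment> \<open>The last difference reaches iterate \<open>Suc K\<close>, one past the window.
      The recursion is defined for every index and stays in \<open>X\<close>, so
      \<open>Fstar\<close> bounds the value of \<open>H\<close> there from below.\<close>
    also have "(\<Sum>k = l..K. ?S (Suc k) - ?S k) = ?S (Suc K) - ?S l"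
      using \<open>l \<le> K\<close> by (intro sum_Suc_diff) simp
    finally show ?thesis
      using smoothed_close [OF H_lipschitz \<eta>, of "x l q"] smoothed_close [OF H_lipschitz \<eta>, of "x (Suc K) q"]
        Fstar [OF x_in_X [OF q, of "Suc K"]] by (simp add: abs_le_iff)
  qed
  then have "(\<integral>q. ?c * (\<Sum>k = l..K. (norm (res (x k q)))\<^sup>2) \<partial>Q)
      \<le> (\<integral>q. H (x l q) - Fstar + 2 * L0 * \<eta> + ?b * (\<Sum>k = l..K. (norm (noise k q))\<^sup>2) \<partial>Q)"
    by (intro integral_mono integrable_mult_right Bochner_Integration.integrable_sum Bochner_Integration.integrable_add
        Bochner_Integration.integrable_diff integrable_res integrable_H integrable_noise_square) auto
  then have "?c * (\<Sum>k = l..K. \<integral>q. (norm (res (x k q)))\<^sup>2 \<partial>Q)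
      \<le> (\<integral>q. H (x l q) \<partial>Q) - Fstar + 2 * L0 * \<eta> + ?b * (\<Sum>k = l..K. \<integral>q. (norm (noise k q))\<^sup>2 \<partial>Q)"
    by (simp add: integrable_res integrable_H integrable_noise_square Q.prob_space)
  also have "(\<Sum>k = l..K. \<integral>q. (norm (noise k q))\<^sup>2 \<partial>Q) \<le> (real DIM('a) * L0)\<^sup>2 * (\<Sum>k = l..K. 1 / (real k + 1))"
    unfolding sum_distrib_left using expectation_noise_square_le by (intro sum_mono) simp
  finally show ?thesis using b by (simp add: mult_left_mono)
qed

lemma expectation_res_output_le:
  assumes step: "real DIM('a) * L0 * \<gamma> < \<eta>" and lam: "0 < lam" "lam < 1" and K: "1 \<le> K"
    and R: "output_index M Q v w lam K R" and Fstar: "\<And>z. z \<in> X \<Longrightarrow> Fstar \<le> H z"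
  shows "(\<integral>q. (norm (res (x (R q) q)))\<^sup>2 \<partial>Q)
       \<le> ((real DIM('a))\<^sup>2 * L0\<^sup>2 * \<gamma> * (1 / 2 - ln lam) * (1 - real DIM('a) * L0 * \<gamma> / (2 * \<eta>))
            + (\<integral>q. H (x (start_index lam K) q) \<partial>Q) - Fstar + 2 * L0 * \<eta>)
         / ((1 - real DIM('a) * L0 * \<gamma> / \<eta>) * (\<gamma> / 4) * (1 - lam) * real K)"
proof -
  let ?l = "start_index lam K"
  let ?c = "(1 - real DIM('a) * L0 * \<gamma> / \<eta>) * (\<gamma> / 4)"
  let ?b = "\<gamma> * (1 - real DIM('a) * L0 * \<gamma> / (2 * \<eta>))"
  let ?E = "\<integral>q. (norm (res (x (R q) q)))\<^sup>2 \<partial>Q"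
  note l = start_index_bounds [OF lam K]
  have b: "0 \<le> ?b" using step \<eta> \<gamma> L0_nonneg by (simp add: field_simps)
  have c: "0 < ?c" using step \<eta> \<gamma> by (simp add: divide_less_eq)
  have "?E = (\<Sum>k = ?l..K. \<integral>q. (norm (res (x k q)))\<^sup>2 \<partial>Q) / real (Suc K - ?l)"
  proof (rule Q.expectation_uniform_index [where N = "info draws" and h = "\<lambda>k q. (norm (res (x k q)))\<^sup>2"])
    have [measurable]: "x k \<in> borel_measurable (info draws)" for k
      by (rule measurable_info_mono [OF x_info past_subset])
    show "(\<lambda>q. (norm (res (x k q)))\<^sup>2) \<in> borel_measurable (info draws)" for k by measurable
  qed (use R l integrable_res in \<open>auto simp: output_index_def sets_info\<close>)
  then have "?c * (real (Suc K - ?l) * ?E) = ?c * (\<Sum>k = ?l..K. \<integral>q. (norm (res (x k q)))\<^sup>2 \<partial>Q)"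
    using l by simp
  also have "\<dots> \<le> (\<integral>q. H (x ?l q) \<partial>Q) - Fstar + 2 * L0 * \<eta>
         + ?b * ((real DIM('a) * L0)\<^sup>2 * (\<Sum>k = ?l..K. 1 / (real k + 1)))"
    using step l by (intro window_bound Fstar) auto
  also have "?b * ((real DIM('a) * L0)\<^sup>2 * (\<Sum>k = ?l..K. 1 / (real k + 1)))
      \<le> ?b * ((real DIM('a) * L0)\<^sup>2 * (1 / 2 - ln lam))"
    using sum_reciprocal_window [OF lam K] b by (intro mult_left_mono) auto
  finally have bound: "?c * (real (Suc K - ?l) * ?E) \<le> (\<integral>q. H (x ?l q) \<partial>Q) - Fstar + 2 * L0 * \<eta>
      + ?b * ((real DIM('a) * L0)\<^sup>2 * (1 / 2 - ln lam))" by simp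
  \<comment> \<open>The ceiling exceeds \<open>lam * real K\<close> by less than one, and the window
    has one index more than \<open>K - ?l\<close>; the two units compensate.\<close>
  have "(1 - lam) * real K \<le> real (Suc K - ?l)"
    using l by (simp add: of_nat_diff algebra_simps)
  then have "?c * ((1 - lam) * real K * ?E) \<le> ?c * (real (Suc K - ?l) * ?E)"
    using c by (intro mult_left_mono mult_right_mono) auto
  also note bound
  finally have "?c * ((1 - lam) * real K * ?E) \<le> (\<integral>q. H (x ?l q) \<partial>Q) - Fstar + 2 * L0 * \<eta>
      + ?b * ((real DIM('a) * L0)\<^sup>2 * (1 / 2 - ln lam))" .
  moreover have "?b * ((real DIM('a) * L0)\<^sup>2 * (1 / 2 - ln lam))
      = (real DIM('a))\<^sup>2 * L0\<^sup>2 * \<gamma> * (1 / 2 - ln lam) * (1 - real DIM('a) * L0 * \<gamma> / (2 * \<eta>))"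
    by (simp only: power_mult_distrib ac_simps)
  moreover have "?c * ((1 - lam) * real K * ?E) = ?E * (?c * (1 - lam) * real K)"
    by (simp only: ac_simps)
  ultimately have "?E * (?c * (1 - lam) * real K)
      \<le> (real DIM('a))\<^sup>2 * L0\<^sup>2 * \<gamma> * (1 / 2 - ln lam) * (1 - real DIM('a) * L0 * \<gamma> / (2 * \<eta>))
            + (\<integral>q. H (x ?l q) \<partial>Q) - Fstar + 2 * L0 * \<eta>"
    by linarith
  moreover have "0 < ?c * (1 - lam) * real K" using c lam K by simp
  ultimately show ?thesis by (subst pos_le_divide_eq)
qed

lemma expectation_res_output_le_trivial:
  assumes [measurable]: "R \<in> measurable Q (count_space UNIV)"
  shows "(\<integral>q. (norm (res (x (R q) q)))\<^sup>2 \<partial>Q) \<le> (real DIM('a) * L0)\<^sup>2"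
proof -
  have [measurable]: "(\<lambda>q. (norm (res (x (R q) q)))\<^sup>2) \<in> borel_measurable Q"
    by (rule measurable_compose_countable [where f = "\<lambda>k q. (norm (res (x k q)))\<^sup>2", OF _ assms]) measurable
  have "(\<integral>q. (norm (res (x (R q) q)))\<^sup>2 \<partial>Q) \<le> (\<integral>q. (real DIM('a) * L0)\<^sup>2 \<partial>Q)"
    using res_square_le [OF x_in_X]
    by (intro integral_mono Q.integrable_const_bound [where B = "(real DIM('a) * L0)\<^sup>2"]) auto
  then show ?thesis by (simp add: Q.prob_space)
qed

end

section \<open>Complexity of the scheme\<close>

text \<open>The Minkowski sum with a ball is the form to which the results on sums of compact or
  convex sets apply.\<close>

lemma enlargement_eq:
  assumes "0 \<le> r"
  shows "enlargement X r = (\<Union>a\<in>X. \<Union>b\<in>cball 0 r. {a + b})"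
proof (intro subset_antisym subsetI)
  fix z assume "z \<in> (\<Union>a\<in>X. \<Union>b\<in>cball 0 r. {a + b})"
  then obtain a b where ab: "a \<in> X" "norm b \<le> r" "z = a + b" by auto
  then have "z = a + r *\<^sub>R (b /\<^sub>R r)" "b /\<^sub>R r \<in> cball 0 1"
    using assms by (cases "r = 0"; simp add: divide_le_eq field_simps)+
  then show "z \<in> enlargement X r" using ab(1) unfolding enlargement_def by blast
next
  fix z assume "z \<in> enlargement X r"
  then obtain a b where ab: "a \<in> X" "norm b \<le> 1" "z = a + r *\<^sub>R b"
    by (auto simp: enlargement_def)
  then have "r *\<^sub>R b \<in> cball 0 r" using assms by (simp add: mult_left_le)
  then show "z \<in> (\<Union>a\<in>X. \<Union>b\<in>cball 0 r. {a + b})" using ab by blast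
qed

lemma cball_subset_enlargement:
  assumes "x \<in> X" "0 \<le> r"
  shows "cball x r \<subseteq> enlargement X r"
proof
  fix z assume "z \<in> cball x r"
  then have "z = x + (z - x)" "z - x \<in> cball 0 r" by (auto simp: dist_norm norm_minus_commute)
  then show "z \<in> enlargement X r" unfolding enlargement_eq [OF assms(2)] using assms(1) by blast
qed

lemma zsol_in_set:
  assumes "closed X" "X \<noteq> {}" "x0 \<in> X"
  shows "zsol X f y \<eta> \<gamma> x0 v w k q \<in> X"
  using assms by (cases k) (auto simp: Let_def closest_point_in_set)

text \<open>Every batch before iteration \<open>K\<close> has size at most \<open>K\<close>. The
  bound has no lower-order term, so squaring the iteration bound gives the sample bound
  directly.\<close>

lemma samples_used_le: "samples_used K \<le> K\<^sup>2"
proof -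
  have "samples_used K \<le> (\<Sum>k<K. K)"
    unfolding samples_used_def batch_size_def by (intro sum_mono) auto
  then show ?thesis by (simp add: power2_eq_square)
qed

text \<open>The trivial bound \<open>err K \<le> D\<close> is what makes the complexity estimate hold without a
  rounding term when \<open>\<epsilon>\<close> is large: then no iteration is needed at all.\<close>

lemma iterations_needed_bounds:
  fixes err :: "nat \<Rightarrow> real" and C D \<epsilon> :: real
  assumes \<epsilon>: "0 < \<epsilon>" and C: "1 < C" and D: "0 < D"
    and trivial: "\<And>K. err K \<le> D" and decay: "\<And>K. 1 \<le> K \<Longrightarrow> err K \<le> (C - 1) * D / real K"
  shows "\<forall>K\<ge>iterations_needed err \<epsilon>. err K \<le> \<epsilon>"
    and "real (iterations_needed err \<epsilon>) \<le> C * (D / \<epsilon>)"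
proof -
  obtain N where N: "\<forall>K\<ge>N. err K \<le> \<epsilon>" "real N \<le> C * (D / \<epsilon>)"
  proof (cases "D \<le> \<epsilon>")
    case True
    then have "\<forall>K\<ge>0. err K \<le> \<epsilon>" using trivial order_trans by blast
    then show ?thesis using that [of 0] C D \<epsilon> by simp
  next
    case False
    let ?A = "(C - 1) * D / \<epsilon>"
    have A: "0 < ?A" using C D \<epsilon> by simp
    have "err K \<le> \<epsilon>" if "nat \<lceil>?A\<rceil> \<le> K" for K
    proof -
      have AK: "?A \<le> real K" using that by linarith
      then have "1 \<le> K" using A by linarith
      then have "err K \<le> (C - 1) * D / real K" by (rule decay)
      also have "\<dots> \<le> \<epsilon>" using AK \<epsilon> \<open>1 \<le> K\<close> by (simp add: field_simps)
      finally show ?thesis .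
    qed
    \<comment> \<open>Rounding up costs at most one unit, which is at most
      \<open>D / \<epsilon>\<close> in this case. The step from \<open>C - 1\<close> to
      \<open>C\<close> pays for it; this is the summand 1 in
      \<open>complexity_const\<close>.\<close>
    moreover have "real (nat \<lceil>?A\<rceil>) \<le> C * (D / \<epsilon>)"
    proof -
      have "?A + D / \<epsilon> = C * (D / \<epsilon>)"
        by (simp add: left_diff_distrib diff_divide_distrib)
      moreover have "1 \<le> D / \<epsilon>" using False \<epsilon> by simp
      moreover have "real (nat \<lceil>?A\<rceil>) \<le> ?A + 1" using A by linarith
      ultimately show ?thesis by linarith
    qed
    ultimately show ?thesis using that by blast
  qed
  show "\<forall>K\<ge>iterations_needed err \<epsilon>. err K \<le> \<epsilon>"
    unfolding iterations_needed_def by (rule LeastI [where P = "\<lambda>N. \<forall>K\<ge>N. err K \<le> \<epsilon>", OF N(1)])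
  have "iterations_needed err \<epsilon> \<le> N"
    unfolding iterations_needed_def by (rule Least_le [where P = "\<lambda>N. \<forall>K\<ge>N. err K \<le> \<epsilon>", OF N(1)])
  then show "real (iterations_needed err \<epsilon>) \<le> C * (D / \<epsilon>)" using N(2) by linarith
qed

theorem corollary4:
  fixes M :: "'w measure" and Q :: "'q measure"
    and X :: "(real ^ 'n) set" and Y :: "(real ^ 'm) set"
    and f :: "real ^ 'n \<Rightarrow> real ^ 'm \<Rightarrow> 'w \<Rightarrow> real"
    and G :: "real ^ 'n \<Rightarrow> real ^ 'm \<Rightarrow> 'w \<Rightarrow> real ^ 'm"
    and y :: "real ^ 'n \<Rightarrow> 'w \<Rightarrow> real ^ 'm"
    and lip lip' :: "'w \<Rightarrow> real"
    and v :: "nat \<Rightarrow> nat \<Rightarrow> 'q \<Rightarrow> real ^ 'n" and w :: "nat \<Rightarrow> nat \<Rightarrow> 'q \<Rightarrow> 'w"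
    and x :: "nat \<Rightarrow> 'q \<Rightarrow> real ^ 'n" and x0 :: "real ^ 'n"
    and F :: "real ^ 'n \<Rightarrow> real"
    and \<eta>0 \<eta> \<gamma> lam L0 n Fstar :: real
  assumes problem: "two_stage_problem M X Y \<eta>0 f G y"
    and B1: "assumption_B1 M X Y \<eta>0 f y lip lip'"
    and B2: "assumption_B2 X Y"
    and B3: "assumption_B3 M X Y G"
    and U: "assumption_U M Q \<eta> v w"
    and params: "0 < \<eta>" "\<eta> < \<eta>0" "0 < \<gamma>" "0 < lam" "lam < 1" "x0 \<in> X"
    and n: "n = real CARD('n)"
    and L0: "L0 = rms M lip"
    and F: "F = f_imp M f y"
    and Fstar: "Fstar = (INF z\<in>X. F z)"
    and x: "x = zsol X f y \<eta> \<gamma> x0 v w"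
  shows
    "(n * L0 * \<gamma> < \<eta> \<longrightarrow>
       (\<forall>K R. real K > 2 / (1 - lam) \<and> output_index M Q v w lam K R \<longrightarrow>
          (\<integral>q. (norm (residual X F \<eta> (1 / \<gamma>) (x (R q) q)))\<^sup>2 \<partial>Q)
          \<le> (n\<^sup>2 * L0\<^sup>2 * \<gamma> * (1 / 2 - ln lam) * (1 - n * L0 * \<gamma> / (2 * \<eta>))
               + (\<integral>q. F (x (start_index lam K) q) \<partial>Q) - Fstar + 2 * L0 * \<eta>)
            / ((1 - n * L0 * \<gamma> / \<eta>) * (\<gamma> / 4) * (1 - lam) * real K)))
     \<and>
     (\<gamma> = \<eta> / (2 * n * L0) \<and> \<eta> = 1 / L0 \<longrightarrow>
       (\<forall>R gap err. (\<forall>K. output_index M Q v w lam K (R K)) \<and>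
          (\<forall>K. (\<integral>q. F (x (start_index lam K) q) \<partial>Q) - Fstar \<le> gap) \<and>
          (\<forall>K. err K = (\<integral>q. (norm (residual X F \<eta> (1 / \<gamma>) (x (R K q) q)))\<^sup>2 \<partial>Q)) \<longrightarrow>
          (\<forall>\<epsilon>>0. \<forall>K\<epsilon>. K\<epsilon> = iterations_needed err \<epsilon> \<longrightarrow>
             (\<forall>K\<ge>K\<epsilon>. err K \<le> \<epsilon>) \<and>
             real K\<epsilon> \<le> complexity_const lam gap * (n\<^sup>2 * L0\<^sup>2 / \<epsilon>) \<and>
             real (samples_used K\<epsilon>) \<le> (complexity_const lam gap)\<^sup>2 * (n ^ 4 * L0 ^ 4 / \<epsilon>\<^sup>2))))"
proof -
  define E where "E = enlargement X \<eta>0"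
  define \<phi> where "\<phi> z \<omega> = implicit_integrand f y (closest_point E z) \<omega>" for z \<omega>
  have \<eta>0: "0 \<le> \<eta>0" using params by simp
  have X: "X \<noteq> {}" "closed X" "bounded X" "convex X" using B2 by (auto simp: assumption_B2_def)
  then have "compact X" by (simp add: compact_eq_bounded_closed)
  have ball_E: "cball z \<eta>0 \<subseteq> E" if "z \<in> X" for z
    unfolding E_def by (rule cball_subset_enlargement [OF that \<eta>0])
  have X_E: "z \<in> E" if "z \<in> X" for z using ball_E [OF that] \<eta>0 by auto
  have E: "E \<noteq> {}" "closed E" "convex E"
  proof -
    show "E \<noteq> {}" using X(1) X_E by blast
    \<comment> \<open>A sum of closed sets need not be closed; compactness of \<open>X\<close> is
      what is used here.\<close>
    show "closed E"
      unfolding E_def enlargement_eq [OF \<eta>0] by (intro compact_imp_closed compact_sums' \<open>compact X\<close> compact_cball)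
    show "convex E"
      unfolding E_def enlargement_eq [OF \<eta>0] by (intro convex_sums X convex_cball)
  qed
  have cpE: "closest_point E z \<in> E" for z using E by (intro closest_point_in_set)
  have \<phi>_E: "\<phi> z \<omega> = f z (y z \<omega>) \<omega>" if "z \<in> E" for z \<omega>
    using that by (simp add: \<phi>_def implicit_integrand_def closest_point_self)
  have xX: "x k q \<in> X" for k q unfolding x by (rule zsol_in_set [OF X(2,1) params(6)])
  interpret M: prob_space M using problem by (simp add: two_stage_problem_def)
  interpret Q: prob_space Q using U by (simp add: assumption_U_def)
  interpret zeroth_order_sampling M Q \<phi> lip X \<eta> \<gamma> x0 v w x
  proof
    show "integrable M (\<phi> z)" for z
      using problem cpE [of z] unfolding two_stage_problem_def E_def \<phi>_def [abs_def] by auto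
    show "(lip \<omega>)-lipschitz_on UNIV (\<lambda>z. \<phi> z \<omega>)" if \<omega>: "\<omega> \<in> space M" for \<omega>
    proof (rule lipschitz_onI)
      have lipE: "(lip \<omega>)-lipschitz_on E (\<lambda>z. implicit_integrand f y z \<omega>)"
        using B1 \<omega> by (auto simp: assumption_B1_def E_def)
      then show "0 \<le> lip \<omega>" by (rule lipschitz_on_nonneg)
      fix a b
      have "dist (\<phi> a \<omega>) (\<phi> b \<omega>) \<le> lip \<omega> * dist (closest_point E a) (closest_point E b)"
        unfolding \<phi>_def by (rule lipschitz_onD [OF lipE cpE cpE])
      also have "\<dots> \<le> lip \<omega> * dist a b"
        using E \<open>0 \<le> lip \<omega>\<close> by (intro mult_left_mono closest_point_lipschitz)
      finally show "dist (\<phi> a \<omega>) (\<phi> b \<omega>) \<le> lip \<omega> * dist a b" .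
    qed
    show "x (Suc k) q = closest_point X (x k q - \<gamma> *\<^sub>R ((1 / real (batch_size k)) *\<^sub>R
        (\<Sum>j = 1..batch_size k. (real DIM(real ^ 'n) * (\<phi> (x k q + v k j q) (w k j q) - \<phi> (x k q) (w k j q))
           / (norm (v k j q) * \<eta>)) *\<^sub>R v k j q)))" if q: "q \<in> space Q" for k q
    proof -
      \<comment> \<open>For \<open>q\<close> in \<open>space Q\<close> the directions have norm
        exactly \<open>\<eta>\<close>, less than \<open>\<eta>0\<close>, so both evaluation points
        lie in \<open>E\<close>, where the extension agrees with the integrand.\<close>
      have zo: "zo_gradient f y \<eta> (x k q) (v k j q) (w k j q)
          = (real DIM(real ^ 'n) * (\<phi> (x k q + v k j q) (w k j q) - \<phi> (x k q) (w k j q))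
              / (norm (v k j q) * \<eta>)) *\<^sub>R v k j q" if j: "j \<in> {1..batch_size k}" for j
      proof -
        have "norm (v k j q) = \<eta>" using U j q by (auto simp: assumption_U_def Pi_iff)
        then have "x k q + v k j q \<in> cball (x k q) \<eta>0" using params by (simp add: dist_norm)
        then have "x k q + v k j q \<in> E" using ball_E [OF xX] by blast
        then show ?thesis using X_E [OF xX] by (simp add: zo_gradient_def \<phi>_E)
      qed
      have "x (Suc k) q = closest_point X (x k q - \<gamma> *\<^sub>R ((1 / real (batch_size k)) *\<^sub>R
          (\<Sum>j = 1..batch_size k. zo_gradient f y \<eta> (x k q) (v k j q) (w k j q))))"
        unfolding x by (simp only: zsol.simps Let_def)
      also note sum.cong [OF refl zo]
      finally show ?thesis .
    qed
    show "x 0 q = x0" for q by (simp add: x)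
  qed (use B1 U X params in \<open>auto simp: assumption_B1_def\<close>)
  have n_DIM: "real DIM(real ^ 'n) = n" by (simp add: n)
  have L0': "zeroth_order_sampling.L0 M lip = L0" by (simp add: L0_def L0)
  have F_E: "F z = H z" if "z \<in> E" for z
    unfolding F H_def f_imp_def using that
    by (intro Bochner_Integration.integral_cong) (simp_all add: \<phi>_def closest_point_self)
  have res: "residual X F \<eta> (1 / \<gamma>) z = res z" if "z \<in> X" for z
  proof -
    have "gradient (smoothed \<eta> F) z = g z"
      unfolding g_def using gradient_smoothed [OF H_lipschitz params(1,2)] F_E ball_E [OF that] by blast
    then show ?thesis by (simp add: residual_def res_def)
  qed
  have res_int: "(\<integral>q. (norm (residual X F \<eta> (1 / \<gamma>) (x (R q) q)))\<^sup>2 \<partial>Q) = (\<integral>q. (norm (res (x (R q) q)))\<^sup>2 \<partial>Q)" for R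
    by (simp add: res xX)
  have F_int: "(\<integral>q. F (x k q) \<partial>Q) = (\<integral>q. H (x k q) \<partial>Q)" for k
    by (simp add: F_E X_E xX)
  have Fstar_le: "Fstar \<le> H z" if "z \<in> X" for z
  proof -
    obtain r where r: "\<And>z. z \<in> X \<Longrightarrow> norm z \<le> r" using X(3) by (auto simp: bounded_iff)
    \<comment> \<open>A real infimum is known to be a lower bound only if the set is bounded below;
      boundedness of \<open>X\<close> and the Lipschitz growth of \<open>H\<close> provide
      this.\<close>
    have "bdd_below (F ` X)"
    proof (rule bdd_belowI2)
      show "- (\<bar>H 0\<bar> + L0 * r) \<le> F z" if "z \<in> X" for z
        using lipschitz_UNIV_growth [OF H_lipschitz r [OF that]] F_E [OF X_E [OF that]] unfolding L0' by linarith
    qed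
    then have "Fstar \<le> F z" unfolding Fstar by (rule cINF_lower [OF _ that])
    then show ?thesis by (simp add: F_E X_E that)
  qed
  have bound: "(\<integral>q. (norm (residual X F \<eta> (1 / \<gamma>) (x (R q) q)))\<^sup>2 \<partial>Q)
          \<le> (n\<^sup>2 * L0\<^sup>2 * \<gamma> * (1 / 2 - ln lam) * (1 - n * L0 * \<gamma> / (2 * \<eta>))
               + (\<integral>q. F (x (start_index lam K) q) \<partial>Q) - Fstar + 2 * L0 * \<eta>)
            / ((1 - n * L0 * \<gamma> / \<eta>) * (\<gamma> / 4) * (1 - lam) * real K)"
    if "n * L0 * \<gamma> < \<eta>" "1 \<le> K" "output_index M Q v w lam K R" for K R
    using expectation_res_output_le [OF _ params(4,5) that(2,3) Fstar_le] that(1)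
    unfolding res_int F_int n_DIM L0' by blast
  show ?thesis
  proof (intro conjI impI allI; (elim conjE)?)
    fix K R assume step: "n * L0 * \<gamma> < \<eta>" and K: "2 / (1 - lam) < real K" and R: "output_index M Q v w lam K R"
    have "0 < 2 / (1 - lam)" using params by simp
    with K have "1 \<le> K" by linarith
    then show "(\<integral>q. (norm (residual X F \<eta> (1 / \<gamma>) (x (R q) q)))\<^sup>2 \<partial>Q)
          \<le> (n\<^sup>2 * L0\<^sup>2 * \<gamma> * (1 / 2 - ln lam) * (1 - n * L0 * \<gamma> / (2 * \<eta>))
               + (\<integral>q. F (x (start_index lam K) q) \<partial>Q) - Fstar + 2 * L0 * \<eta>)
            / ((1 - n * L0 * \<gamma> / \<eta>) * (\<gamma> / 4) * (1 - lam) * real K)"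
      using step R by (intro bound)
  next
    fix R :: "nat \<Rightarrow> 'q \<Rightarrow> nat" and gap :: real and err :: "nat \<Rightarrow> real" and \<epsilon> :: real and K\<epsilon> :: nat
    assume \<gamma>_eq: "\<gamma> = \<eta> / (2 * n * L0)" and \<eta>_eq: "\<eta> = 1 / L0"
      and R: "\<forall>K. output_index M Q v w lam K (R K)"
      and gap: "\<forall>K. (\<integral>q. F (x (start_index lam K) q) \<partial>Q) - Fstar \<le> gap"
      and err: "\<forall>K. err K = (\<integral>q. (norm (residual X F \<eta> (1 / \<gamma>) (x (R K q) q)))\<^sup>2 \<partial>Q)"
      and \<epsilon>: "0 < \<epsilon>" and K\<epsilon>: "K\<epsilon> = iterations_needed err \<epsilon>"
    \<comment> \<open>Since \<open>1 / 0 = 0\<close>, positivity of \<open>\<eta>\<close> excludes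
      \<open>L0 = 0\<close>.\<close>
    have L0_pos: "0 < L0" using params(1) \<eta>_eq by simp
    have n1: "1 \<le> n" by (simp add: n Suc_le_eq)
    let ?C = "complexity_const lam gap" and ?D = "n\<^sup>2 * L0\<^sup>2"
    define a where "a = 1 / 2 - ln lam"
    have a: "0 < a" using ln_less_zero [OF params(4,5)] by (simp add: a_def)
    \<comment> \<open>\<open>gap\<close> dominates a nonnegative quantity; its sign is what lets
      \<open>gap + 2\<close> be multiplied by \<open>n\<close> below.\<close>
    have "Fstar \<le> (\<integral>q. H (x (start_index lam 0) q) \<partial>Q)"
      by (rule Q.integral_ge_const [OF integrable_H]) (simp add: Fstar_le xX)
    then have gap0: "0 \<le> gap" using gap [rule_format, of 0] F_int [of "start_index lam 0"] by linarith
    have C: "?C - 1 = 16 / (1 - lam) * (3 / 8 * a + gap + 2)"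
      by (simp add: complexity_const_def a_def)
    have "0 < 16 / (1 - lam) * (3 / 8 * a + gap + 2)"
      using a gap0 params by (intro mult_pos_pos) auto
    then have C1: "1 < ?C" using C by linarith
    have D: "0 < ?D" using L0_pos n1 by simp
    have trivial: "err K \<le> ?D" for K
      using expectation_res_output_le_trivial [of "R K"] R
      unfolding n_DIM L0' err [rule_format] res_int by (simp add: output_index_def power_mult_distrib)
    have decay: "err K \<le> (?C - 1) * ?D / real K" if K: "1 \<le> K" for K
    proof -
      let ?G = "(\<integral>q. F (x (start_index lam K) q) \<partial>Q) - Fstar"
      \<comment> \<open>The step is half the critical one, which fixes the factors 3/4 and 1/2. With
        \<open>\<gamma> = 1 / (2 * n * L0\<^sup>2)\<close> the noise term becomes
        \<open>3 / 8 * a * n\<close> and the denominator brings in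
        \<open>16 * n * L0\<^sup>2\<close>, hence the constants of
        \<open>complexity_const\<close>.\<close>
      have s: "n * L0 * \<gamma> = \<eta> / 2" using \<gamma>_eq L0_pos n1 by simp
      have "err K \<le> (n\<^sup>2 * L0\<^sup>2 * \<gamma> * a * (1 - n * L0 * \<gamma> / (2 * \<eta>)) + ?G + 2 * L0 * \<eta>)
            / ((1 - n * L0 * \<gamma> / \<eta>) * (\<gamma> / 4) * (1 - lam) * real K)"
        unfolding err [rule_format] a_def add_diff_eq
        by (rule bound [OF _ K R [rule_format]]) (use s params(1) in linarith)
      also have "\<dots> = (n / 2 * a * (3 / 4) + ?G + 2) / (1 / 2 * (1 / (8 * n * L0\<^sup>2)) * (1 - lam) * real K)"
      proof -
        have "1 - n * L0 * \<gamma> / (2 * \<eta>) = 3 / 4" "1 - n * L0 * \<gamma> / \<eta> = 1 / 2"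
          unfolding s using params(1) by simp_all
        moreover have "n\<^sup>2 * L0\<^sup>2 * \<gamma> = n / 2" "\<gamma> / 4 = 1 / (8 * n * L0\<^sup>2)" "2 * L0 * \<eta> = 2"
          using \<gamma>_eq \<eta>_eq L0_pos n1 by (simp_all add: power2_eq_square)
        ultimately show ?thesis by (simp only:)
      qed
      also have "\<dots> = (3 / 8 * a * n + ?G + 2) * (16 * n * L0\<^sup>2 / ((1 - lam) * real K))"
        using L0_pos n1 K params by (simp add: field_simps)
      also have "\<dots> \<le> ((3 / 8 * a + gap + 2) * n) * (16 * n * L0\<^sup>2 / ((1 - lam) * real K))"
      proof (rule mult_right_mono)
        \<comment> \<open>The gap and the 2 carry no factor \<open>n\<close>; since \<open>n\<close>
          is at least 1 they can take one, and the whole bound becomes a multiple of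
          \<open>n\<^sup>2 * L0\<^sup>2\<close>.\<close>
        have "gap + 2 \<le> (gap + 2) * n" using gap0 n1 by (simp add: mult_le_cancel_left1)
        then show "3 / 8 * a * n + ?G + 2 \<le> (3 / 8 * a + gap + 2) * n"
          using gap [rule_format, of K] by (simp add: algebra_simps)
        show "0 \<le> 16 * n * L0\<^sup>2 / ((1 - lam) * real K)" using n1 params by simp
      qed
      also have "\<dots> = (?C - 1) * ?D / real K"
        unfolding C by (simp add: power2_eq_square)
      finally show ?thesis .
    qed
    note iter = iterations_needed_bounds [OF \<epsilon> C1 D trivial decay, folded K\<epsilon>]
    show "err K \<le> \<epsilon>" if "K\<epsilon> \<le> K" for K using iter(1) that by blast
    show "real K\<epsilon> \<le> ?C * (n\<^sup>2 * L0\<^sup>2 / \<epsilon>)" by (rule iter(2))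
    have "real (samples_used K\<epsilon>) \<le> (real K\<epsilon>)\<^sup>2"
      using samples_used_le [of K\<epsilon>] by (metis of_nat_le_iff of_nat_power)
    also have "\<dots> \<le> (?C * (?D / \<epsilon>))\<^sup>2"
      using iter(2) by (intro power_mono) auto
    also have "\<dots> = ?C\<^sup>2 * (n ^ 4 * L0 ^ 4 / \<epsilon>\<^sup>2)"
      by (simp add: power_mult_distrib power_divide flip: power_mult)
    finally show "real (samples_used K\<epsilon>) \<le> ?C\<^sup>2 * (n ^ 4 * L0 ^ 4 / \<epsilon>\<^sup>2)" .
  qed
qed

end
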